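(* Let $(a,\lambda,k)\in\mathbb R\times\sigma_D\times\mathbb Z_N$, let $\phi=\varphi'(1,\lambda)$, and let $\mathcal H_k^a(\lambda)=\{\psi\in\mathfrak D(H_k^a):H_k^a\psi=\lambda\psi\}$. (i) Every eigenfunction in $\mathcal H_k^a(\lambda)$ vanishes at all vertices of $\Gamma^1$. (ii) There exist $\psi^{(0,\nu)}=(\psi^{(0,\nu)}_{n,j})\in\mathcal H_k^a(\lambda)$, $\nu=1,2$, such that: - $\psi^{(0,\nu)}$ is supported in $\bigcup_{\ell\in\{0,1\}}\bigcup_{j=1}^6\Gamma_{\ell,j}$; - every shift $\psi^{(n,\nu)}$, defined by $\psi^{(n,\nu)}_{m,j}=\psi^{(0,\nu)}_{m-n,j}$, belongs to $\mathcal H_k^a(\lambda)$ for $n\in\mathbb Z$; - every $f\in\mathcal H_k^a(\lambda)$ satisfies $f=\sum_{(n,\nu)\in\mathbb Z\times\{1,2\}}\hat f_{n,\nu}\psi^{(n,\nu)}$ with $(\hat f_{n,1},\hat f_{n,2})_{n\in\mathbb Z}\in\ell^2\oplus\ell^2$. The coefficients are as follows: - If $(s_k,\phi^2)=(0,1)$, then $\hat f_{n,1}=f'_{n,1}(0)$ and $\hat f_{n,2}=f'_{n,2}(0)$. - If $(s_k,\phi^2)\neq(0,1)$, then $\tilde\varkappa_1=1-s^ke^{2ia}\phi^2\ne0$, $\tilde\varkappa_2=1-s^ke^{2ia}\phi^4\neq0$, and $$\hat f_{n,1}=\frac{f'_{n,5}(0)+s^k\phi e^{i(a+a_1)}f'_{n,6}(0)}{\tilde\varkappa_1\tilde\varkappa_2},\qquad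 \hat f_{n,2}=-\frac{e^{ia_1}f'_{n,6}(0)+\phi e^{ia}f'_{n,5}(0)}{\tilde\varkappa_1\tilde\varkappa_2}.$$ The map $f\mapsto(\hat f_{n,1},\hat f_{n,2})_{n\in\mathbb Z}$ is a linear isomorphism between $\mathcal H_k^a(\lambda)$ and $\ell^2\oplus\ell^2$.
   Context: Fix an integer $N\ge1$ and a real potential $q\in L^2(0,1)$. For $\lambda\in\mathbb C$, let $\vartheta(t,\lambda),\varphi(t,\lambda)$ solve $-y''+qy=\lambda y$ with $\vartheta(0)=\varphi'(0)=1$ and $\vartheta'(0)=\varphi(0)=0$. $\sigma_D$ is the Dirichlet spectrum of $-y''+qy=\lambda y$, $y(0)=y(1)=0$. Let $\Gamma^1$ be the graph with edges $\Gamma_{n,j}$, $(n,j)\in\mathbb Z\times\{1,\dots,6\}$, each identified with $[0,1]$, and $L^2(\Gamma^1)=\bigoplus L^2(0,1)$. The edges meet at vertices as encoded by the boundary conditions below: for each $n$, the endpoints $\Gamma_{n,1}(1),\Gamma_{n,2}(0),\Gamma_{n,5}(0)$ form a vertex, as do $\Gamma_{n,2}(1),\Gamma_{n,3}(0),\Gamma_{n,6}(0)$; $\Gamma_{n,3}(1),\Gamma_{n,4}(0),\Gamma_{n-1,6}(1)$; and $\Gamma_{n,4}(1),\Gamma_{n,1}(0),\Gamma_{n-1,5}(1)$. Let $a_1,a_2\in\mathbb R$, $a=a_1+a_2$, $s=e^{2\pi i/N}$, $k\in\mathbb Z_N$, and $s_k=\sin(\pi k/N+a)$. The boundary conditions (BC)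 for a family $f=(f_{n,j})$ are, for all $n\in\mathbb Z$: - $e^{ia_1}f_{n,1}(1)=f_{n,2}(0)=f_{n,5}(0)$; - $e^{ia_2}f_{n,2}(1)=f_{n,3}(0)=f_{n,6}(0)$; - $e^{ia_1}f_{n,3}(1)=f_{n,4}(0)=e^{ia_1}f_{n-1,6}(1)$; - $e^{ia_2}s^kf_{n,4}(1)=f_{n,1}(0)=e^{-ia_1}f_{n-1,5}(1)$; - $e^{ia_1}f'_{n,1}(1)-f'_{n,2}(0)-f'_{n,5}(0)=0$; - $e^{ia_2}f'_{n,2}(1)-f'_{n,3}(0)-f'_{n,6}(0)=0$; - $e^{ia_1}f'_{n,3}(1)-f'_{n,4}(0)+e^{ia_1}f'_{n-1,6}(1)=0$; - $e^{ia_2}s^kf'_{n,4}(1)-f'_{n,1}(0)+e^{-ia_1}f'_{n-1,5}(1)=0$. $H_k^a$ acts in $L^2(\Gamma^1)$ by $(H_k^af)_{n,j}=-f''_{n,j}+qf_{n,j}$ with domain $\mathfrak D(H_k^a)$ consisting of $f$ with $(f_{n,j}),(f''_{n,j})\in L^2(\Gamma^1)$ satisfying (BC). *)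

theory Defs
  imports "HOL-Analysis.Analysis"
begin

definition d01 :: "(real \<Rightarrow> complex) \<Rightarrow> real \<Rightarrow> complex" where
  "d01 y t = vector_derivative y (at t within {0..1})"

text \<open>y2 is a (weak) second derivative of y on [0,1]: y is C^1 on [0,1] with derivative y1,
  and y1 is the indefinite integral of y2 (so y1 is absolutely continuous, y1' = y2 a.e.).\<close>
definition has_d2 :: "(real \<Rightarrow> complex) \<Rightarrow> (real \<Rightarrow> complex) \<Rightarrow> bool" where
  "has_d2 y y2 \<longleftrightarrow> (\<exists>y1. (\<forall>t\<in>{0..1}. (y has_vector_derivative y1 t) (at t within {0..1})) \<and>
                        (\<forall>t\<in>{0..1}. (y2 has_integral (y1 t - y1 0)) {0..t}))"

definition sq_int01 :: "(real \<Rightarrow> complex) \<Rightarrow> bool" where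
  "sq_int01 g \<longleftrightarrow> g measurable_on {0..1} \<and> (\<lambda>t. (cmod (g t))\<^sup>2) integrable_on {0..1}"

definition l2_graph :: "(int \<Rightarrow> nat \<Rightarrow> real \<Rightarrow> complex) \<Rightarrow> bool" where
  "l2_graph g \<longleftrightarrow> (\<forall>n. \<forall>j\<in>{1..6}. sq_int01 (g n j)) \<and>
     ((\<lambda>(n,j). integral {0..1} (\<lambda>t. (cmod (g n j t))\<^sup>2)) summable_on (UNIV \<times> {1..6::nat}))"

definition l2_seq :: "(int \<Rightarrow> complex) \<Rightarrow> bool" where
  "l2_seq c \<longleftrightarrow> (\<lambda>n. (cmod (c n))\<^sup>2) summable_on UNIV"

definition sl_sol :: "(real \<Rightarrow> real) \<Rightarrow> complex \<Rightarrow> (real \<Rightarrow> complex) \<Rightarrow> bool" where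
  "sl_sol q \<mu> y \<longleftrightarrow> has_d2 y (\<lambda>t. (complex_of_real (q t) - \<mu>) * y t)"

definition dir_spec :: "(real \<Rightarrow> real) \<Rightarrow> complex set" where
  "dir_spec q = {\<mu>. \<exists>y. sl_sol q \<mu> y \<and> y 0 = 0 \<and> y 1 = 0 \<and> (\<exists>t\<in>{0..1}. y t \<noteq> 0)}"

definition phi_d1 :: "(real \<Rightarrow> real) \<Rightarrow> complex \<Rightarrow> complex" where
  "phi_d1 q \<mu> = (THE c. \<exists>y. sl_sol q \<mu> y \<and> y 0 = 0 \<and> d01 y 0 = 1 \<and> d01 y 1 = c)"

definition sroot :: "nat \<Rightarrow> complex" where
  "sroot N = cis (2 * pi / real N)"

definition BC :: "real \<Rightarrow> real \<Rightarrow> nat \<Rightarrow> nat \<Rightarrow> (int \<Rightarrow> nat \<Rightarrow> real \<Rightarrow> complex) \<Rightarrow> bool" where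
  "BC a1 a2 N k f \<longleftrightarrow> (\<forall>n::int.
     cis a1 * f n 1 1 = f n 2 0 \<and> f n 2 0 = f n 5 0 \<and>
     cis a2 * f n 2 1 = f n 3 0 \<and> f n 3 0 = f n 6 0 \<and>
     cis a1 * f n 3 1 = f n 4 0 \<and> f n 4 0 = cis a1 * f (n - 1) 6 1 \<and>
     cis a2 * sroot N ^ k * f n 4 1 = f n 1 0 \<and> f n 1 0 = cis (- a1) * f (n - 1) 5 1 \<and>
     cis a1 * d01 (f n 1) 1 - d01 (f n 2) 0 - d01 (f n 5) 0 = 0 \<and>
     cis a2 * d01 (f n 2) 1 - d01 (f n 3) 0 - d01 (f n 6) 0 = 0 \<and>
     cis a1 * d01 (f n 3) 1 - d01 (f n 4) 0 + cis a1 * d01 (f (n - 1) 6) 1 = 0 \<and>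
     cis a2 * sroot N ^ k * d01 (f n 4) 1 - d01 (f n 1) 0 + cis (- a1) * d01 (f (n - 1) 5) 1 = 0)"

definition dom_H :: "real \<Rightarrow> real \<Rightarrow> nat \<Rightarrow> nat \<Rightarrow> (int \<Rightarrow> nat \<Rightarrow> real \<Rightarrow> complex)
    \<Rightarrow> (int \<Rightarrow> nat \<Rightarrow> real \<Rightarrow> complex) \<Rightarrow> bool" where
  "dom_H a1 a2 N k f f2 \<longleftrightarrow> (\<forall>n. \<forall>j\<in>{1..6}. has_d2 (f n j) (f2 n j)) \<and>
      l2_graph f \<and> l2_graph f2 \<and> BC a1 a2 N k f"

definition eig_space :: "(real \<Rightarrow> real) \<Rightarrow> real \<Rightarrow> real \<Rightarrow> nat \<Rightarrow> nat \<Rightarrow> complex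
    \<Rightarrow> (int \<Rightarrow> nat \<Rightarrow> real \<Rightarrow> complex) set" where
  "eig_space q a1 a2 N k \<mu> = {f. \<exists>f2. dom_H a1 a2 N k f f2 \<and>
      (\<forall>n. \<forall>j\<in>{1..6}. negligible {t\<in>{0..1}. - f2 n j t + complex_of_real (q t) * f n j t \<noteq> \<mu> * f n j t})}"

text \<open>Equality of two families as elements of L^2(Gamma^1) (pointwise on the edges; both
  are continuous on each edge, so this is equality in L^2).\<close>
definition graph_eq :: "(int \<Rightarrow> nat \<Rightarrow> real \<Rightarrow> complex) \<Rightarrow> (int \<Rightarrow> nat \<Rightarrow> real \<Rightarrow> complex) \<Rightarrow> bool" where
  "graph_eq f g \<longleftrightarrow> (\<forall>n. \<forall>j\<in>{1..6}. \<forall>t\<in>{0..1}. f n j t = g n j t)"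

definition s_k :: "real \<Rightarrow> real \<Rightarrow> nat \<Rightarrow> nat \<Rightarrow> real" where
  "s_k a1 a2 N k = sin (pi * real k / real N + (a1 + a2))"

definition kappa1 :: "real \<Rightarrow> real \<Rightarrow> nat \<Rightarrow> nat \<Rightarrow> complex \<Rightarrow> complex" where
  "kappa1 a1 a2 N k \<phi> = 1 - sroot N ^ k * cis (2 * (a1 + a2)) * \<phi>\<^sup>2"

definition kappa2 :: "real \<Rightarrow> real \<Rightarrow> nat \<Rightarrow> nat \<Rightarrow> complex \<Rightarrow> complex" where
  "kappa2 a1 a2 N k \<phi> = 1 - sroot N ^ k * cis (2 * (a1 + a2)) * \<phi> ^ 4"

definition hatf :: "real \<Rightarrow> real \<Rightarrow> nat \<Rightarrow> nat \<Rightarrow> complex \<Rightarrow> (int \<Rightarrow> nat \<Rightarrow> real \<Rightarrow> complex)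
    \<Rightarrow> int \<Rightarrow> nat \<Rightarrow> complex" where
  "hatf a1 a2 N k \<phi> f n \<nu> =
     (if s_k a1 a2 N k = 0 \<and> \<phi>\<^sup>2 = 1 then
        (if \<nu> = 1 then d01 (f n 1) 0 else d01 (f n 2) 0)
      else if \<nu> = 1 then
        (d01 (f n 5) 0 + sroot N ^ k * \<phi> * cis (a1 + a2 + a1) * d01 (f n 6) 0)
          / (kappa1 a1 a2 N k \<phi> * kappa2 a1 a2 N k \<phi>)
      else
        - (cis a1 * d01 (f n 6) 0 + \<phi> * cis (a1 + a2) * d01 (f n 5) 0)
          / (kappa1 a1 a2 N k \<phi> * kappa2 a1 a2 N k \<phi>))"

definition shift :: "int \<Rightarrow> (int \<Rightarrow> nat \<Rightarrow> real \<Rightarrow> complex) \<Rightarrow> (int \<Rightarrow> nat \<Rightarrow> real \<Rightarrow> complex)" where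
  "shift n \<psi> = (\<lambda>m j t. \<psi> (m - n) j t)"

end

theory Submission
  imports Defs
begin

text \<open>At a Dirichlet eigenvalue the solution \<open>w\<close> with \<open>w(0) = 0\<close>, \<open>w'(0) = 1\<close> also vanishes at \<open>1\<close>.
  For every solution \<open>g\<close> on an edge the Wronskian with \<open>w\<close> gives \<open>g(1) w'(1) = g(0)\<close> and
  \<open>g(0) = 2 \<integral> g w'\<close>. The first relation and continuity at the vertices make the value at one family of
  vertices independent of the cell, and by the second this value is square summable, hence zero.
  So an eigenfunction is \<open>A\<^sub>n\<^sub>j w\<close> on each edge, and only the Kirchhoff conditions remain: a linear
  recurrence for \<open>A\<close>, whose square-summable solutions are parametrised freely by two sequences, each
  influencing two consecutive cells. In the degenerate case the recurrence leaves a
  cell-independent quantity, which square summability again forces to vanish.\<close>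

section \<open>Linear equations with integrable potential\<close>

text \<open>Since \<open>q\<close> is only in L^2, the derivative of a solution is merely absolutely
  continuous: a Wronskian cannot be differentiated pointwise, so all identities for it are proved in
  integrated form. The two kappas come from the geometry of a cell. Edges 1 to 4 form a cycle; going
  round it once multiplies a slope by the phase s^k e^(2ia) and by \<phi>^4, and kappa2 is 1 minus
  this product. If it is nonzero, the slopes on edges 5 and 6, which lead to the next cell,
  determine the slopes on the cycle. Before division by kappa1 kappa2, the coefficients are linear
  in these two slopes, with determinant kappa1 up to a unimodular factor. The division by the
  product leaves basic eigenfunctions whose amplitudes contain no denominators. Both kappas are
  nonzero outside the degenerate case because the phase has modulus 1 and \<phi> is real; since
  \<mu> enters as a complex number, the reality of \<phi> rests on the self-adjointness of the
  Dirichlet problem. In the degenerate case the cycle factor is 1, and the slopes on edges 1 and 2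
  serve as free data instead.\<close>

lemma has_integral_increment:
  fixes v g :: "real \<Rightarrow> complex"
  assumes dv: "\<And>t. t \<in> {0..1} \<Longrightarrow> (g has_integral (v t - v 0)) {0..t}"
    and st: "0 \<le> s" "s \<le> t" "t \<le> 1"
  shows "(g has_integral (v t - v s)) {s..t}"
proof -
  have gt: "(g has_integral (v t - v 0)) {0..t}" and gs: "(g has_integral (v s - v 0)) {0..s}"
    using dv st by auto
  have "g integrable_on {s..t}"
    using integrable_on_subinterval[of g "{0..t}" s t] gt st by (auto simp: has_integral_iff)
  then have "(g has_integral integral {s..t} g) {s..t}" by (rule integrable_integral)
  moreover from has_integral_combine[OF st(1,2) gs this] have
    "v s - v 0 + integral {s..t} g = v t - v 0" using gt has_integral_unique by blast
  then have "integral {s..t} g = v t - v s" by (simp add: algebra_simps)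
  ultimately show ?thesis by simp
qed

lemma has_integral_norm_bound:
  fixes f :: "real \<Rightarrow> complex"
  assumes "(f has_integral I) S" "(g has_integral B) S" "\<And>x. x \<in> S \<Longrightarrow> norm (f x) \<le> g x"
  shows "norm I \<le> B"
  using integral_norm_bound_integral[of f S g] assms by (auto simp: has_integral_iff)

text \<open>Continuity of \<open>G\<close> makes the bound o(t - s), so \<open>F\<close> has
  derivative 0 at every point. A derivative that vanishes only almost everywhere would not suffice
  for constancy.\<close>

lemma increment_bound_imp_constant:
  fixes F :: "real \<Rightarrow> complex" and G :: "real \<Rightarrow> real"
  assumes contG: "continuous_on {0..1} G" and "C \<ge> 0"
    and FG: "\<And>s t. 0 \<le> s \<Longrightarrow> s \<le> t \<Longrightarrow> t \<le> 1 \<Longrightarrow> norm (F t - F s) \<le> C * (t - s) * (G t - G s)"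
    and t: "t \<in> {0..1}"
  shows "F t = F 0"
proof -
  have bound: "norm (F y - F x) \<le> C * \<bar>y - x\<bar> * \<bar>G y - G x\<bar>" if "x \<in> {0..1}" "y \<in> {0..1}" for x y
  proof (cases "x \<le> y")
    case True
    have "norm (F y - F x) \<le> C * \<bar>y - x\<bar> * (G y - G x)" using FG[of x y] True that by auto
    also have "\<dots> \<le> C * \<bar>y - x\<bar> * \<bar>G y - G x\<bar>" using \<open>C \<ge> 0\<close> by (intro mult_left_mono) auto
    finally show ?thesis .
  next
    case False
    have "norm (F y - F x) \<le> C * \<bar>y - x\<bar> * (G x - G y)" using FG[of y x] False that
      by (auto simp: norm_minus_commute)
    also have "\<dots> \<le> C * \<bar>y - x\<bar> * \<bar>G y - G x\<bar>" using \<open>C \<ge> 0\<close> by (intro mult_left_mono) auto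
    finally show ?thesis .
  qed
  have "(F has_derivative (\<lambda>h. 0)) (at x within {0..1})" if x: "x \<in> {0..1}" for x
    unfolding has_derivative_within_alt2
  proof (intro conjI allI impI)
    fix e :: real assume "e > 0"
    define d where "d = e / (C + 1)"
    have "d > 0" using \<open>e > 0\<close> \<open>C \<ge> 0\<close> by (simp add: d_def)
    have "(G \<longlongrightarrow> G x) (at x within {0..1})" using contG x by (simp add: continuous_on)
    then have "eventually (\<lambda>y. dist (G y) (G x) < d) (at x within {0..1})"
      using \<open>d > 0\<close> tendstoD by blast
    then show "eventually (\<lambda>y. norm (F y - F x - 0) \<le> e * norm (y - x)) (at x within {0..1})"
      unfolding eventually_at_filter
    proof (rule eventually_mono, intro impI)
      fix y assume a: "y \<noteq> x \<longrightarrow> y \<in> {0..1} \<longrightarrow> dist (G y) (G x) < d" "y \<noteq> x" "y \<in> {0..1}"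
      have "norm (F y - F x) \<le> C * \<bar>y - x\<bar> * \<bar>G y - G x\<bar>" using bound x a by auto
      also have "\<dots> \<le> C * \<bar>y - x\<bar> * d"
        using a \<open>C \<ge> 0\<close> by (intro mult_left_mono) (auto simp: dist_real_def)
      also have "\<dots> = (C * d) * \<bar>y - x\<bar>" by simp
      also have "\<dots> \<le> e * \<bar>y - x\<bar>"
        using \<open>C \<ge> 0\<close> \<open>e > 0\<close> by (intro mult_right_mono) (auto simp: d_def field_simps)
      finally show "norm (F y - F x - 0) \<le> e * norm (y - x)" by simp
    qed
  qed auto
  then show ?thesis using has_derivative_zero_unique[of "{0..1}" F t 0] t by auto
qed

lemma absolutely_integrable_mult_continuous:
  fixes V y :: "real \<Rightarrow> complex"
  assumes V: "V absolutely_integrable_on {0..1}" and cy: "continuous_on {0..1} y"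
  shows "(\<lambda>s. V s * y s) absolutely_integrable_on {0..1}"
proof -
  have "(\<lambda>s. y s * V s) absolutely_integrable_on {0..1}"
  proof (rule absolutely_integrable_bounded_measurable_product[OF bilinear_times])
    show "y \<in> borel_measurable (lebesgue_on {0..1})"
      by (rule continuous_imp_measurable_on_sets_lebesgue[OF cy]) auto
    show "bounded (y ` {0..1})" by (intro compact_imp_bounded compact_continuous_image cy) auto
  qed (use V in auto)
  then show ?thesis by (simp add: mult.commute)
qed

text \<open>\<open>v\<close> is only differentiable almost everywhere; the difference of the two sides is nevertheless
  differentiable everywhere with derivative \<open>0\<close>, since its increments are
  \<open>O(\<bar>t - s\<bar> \<integral> \<bar>g\<bar>)\<close> with the integral taken over the interval from \<open>s\<close> to \<open>t\<close>.\<close>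

lemma integration_by_parts_indefinite:
  fixes u u1 v g :: "real \<Rightarrow> complex"
  assumes du: "\<And>t. t \<in> {0..1} \<Longrightarrow> (u has_vector_derivative u1 t) (at t within {0..1})"
    and cu1: "continuous_on {0..1} u1"
    and dv: "\<And>t. t \<in> {0..1} \<Longrightarrow> (g has_integral (v t - v 0)) {0..t}"
    and g: "g absolutely_integrable_on {0..1}"
    and T: "T \<in> {0..1}"
  shows "((\<lambda>s. u1 s * v s + u s * g s) has_integral (u T * v T - u 0 * v 0)) {0..T}"
proof -
  have cu: "continuous_on {0..1} u"
    using du by (rule continuous_on_vector_derivative)
  have gi: "g integrable_on {0..1}" and gn: "(\<lambda>s. norm (g s)) integrable_on {0..1}"
    using g by (auto simp: absolutely_integrable_on_def)
  have vint: "v t = v 0 + integral {0..t} g" if "t \<in> {0..1}" for t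
    using dv[OF that] by (auto simp: has_integral_iff)
  have "continuous_on {0..1} (\<lambda>t. v 0 + integral {0..t} g)"
    by (intro continuous_intros indefinite_integral_continuous_1 gi)
  then have cv: "continuous_on {0..1} v" by (rule continuous_on_eq) (rule vint[symmetric])
  have ug: "(\<lambda>s. u s * g s) absolutely_integrable_on {0..1}"
    using absolutely_integrable_mult_continuous[OF g cu] by (simp add: mult.commute)
  define h where "h = (\<lambda>s. u1 s * v s + u s * g s)"
  have "(\<lambda>s. u1 s * v s) integrable_on {0..1}"
    by (intro integrable_continuous_real continuous_intros cu1 cv)
  then have hi: "h integrable_on {0..1}" unfolding h_def
    using ug by (intro integrable_add) (auto simp: absolutely_integrable_on_def)
  have "bounded (u1 ` {0..1})" by (intro compact_imp_bounded compact_continuous_image cu1) auto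
  then obtain L where L: "\<And>s. s \<in> {0..1} \<Longrightarrow> norm (u1 s) \<le> L"
    unfolding bounded_iff by blast
  have L0: "L \<ge> 0" using L[of 0] norm_ge_zero[of "u1 0"] by (smt (verit) atLeastAtMost_iff)
  define G where "G = (\<lambda>t. integral {0..t} (\<lambda>s. norm (g s)))"
  have cG: "continuous_on {0..1} G" unfolding G_def by (rule indefinite_integral_continuous_1[OF gn])
  define F where "F = (\<lambda>t. integral {0..t} h - u t * v t)"
  have key: "norm (F t - F s) \<le> (2 * L) * (t - s) * (G t - G s)"
    if st: "0 \<le> s" "s \<le> t" "t \<le> 1" for s t
  proof -
    have sub: "{s..t} \<subseteq> {0..1}" using st by auto
    have i1: "(h has_integral (integral {0..t} h - integral {0..s} h)) {s..t}"
    proof -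
      have "h integrable_on {0..t}" "h integrable_on {s..t}"
        using hi st by (auto intro: integrable_on_subinterval)
      with Henstock_Kurzweil_Integration.integral_combine[OF st(1,2), of h] show ?thesis by (auto simp: has_integral_iff algebra_simps)
    qed
    have i2: "((\<lambda>s. norm (g s)) has_integral (G t - G s)) {s..t}"
    proof -
      have "(\<lambda>s. norm (g s)) integrable_on {0..t}" "(\<lambda>s. norm (g s)) integrable_on {s..t}"
        using gn st by (auto intro: integrable_on_subinterval)
      with Henstock_Kurzweil_Integration.integral_combine[OF st(1,2), of "\<lambda>s. norm (g s)"] show ?thesis
        by (auto simp: has_integral_iff algebra_simps G_def)
    qed
    have i3: "(u1 has_integral (u r - u s)) {s..r}" if "r \<in> {s..t}" for r
    proof (rule fundamental_theorem_of_calculus)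
      fix x assume "x \<in> {s..r}"
      then have "x \<in> {0..1}" "{s..r} \<subseteq> {0..1}" using st that by auto
      then show "(u has_vector_derivative u1 x) (at x within {s..r})"
        using du has_vector_derivative_within_subset by blast
    qed (use that in auto)
    have i4: "(g has_integral (v t - v s)) {s..t}" by (rule has_integral_increment[OF dv st])
    have vv: "norm (v r - v t) \<le> G t - G s" if "r \<in> {s..t}" for r
    proof -
      have a: "(g has_integral (v t - v r)) {r..t}" using has_integral_increment[OF dv, of r t] st that by auto
      have b: "(\<lambda>s. norm (g s)) integrable_on {r..t}"
        using gn st that by (auto intro: integrable_on_subinterval)
      have "norm (v t - v r) \<le> integral {r..t} (\<lambda>s. norm (g s))"
        using integral_norm_bound_integral[of g "{r..t}" "\<lambda>s. norm (g s)"] a b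
        by (auto simp: has_integral_iff)
      also have "\<dots> \<le> integral {s..t} (\<lambda>s. norm (g s))"
        by (rule integral_subset_le) (use b i2 that in \<open>auto simp: has_integral_iff\<close>)
      also have "\<dots> = G t - G s" using i2 by (simp add: has_integral_iff)
      finally show ?thesis by (simp add: norm_minus_commute)
    qed
    have G0: "G t - G s \<ge> 0" using vv[of t] st norm_ge_zero by fastforce
    have uu: "norm (u r - u s) \<le> L * (t - s)" if "r \<in> {s..t}" for r
    proof -
      have "norm (u r - u s) \<le> L * measure lborel {s..r}"
        by (rule has_integral_bound_real[OF L0 finite.emptyI i3[OF that]]) (use L sub that in auto)
      also have "\<dots> \<le> L * (t - s)" using that L0 by (auto intro: mult_left_mono)
      finally show ?thesis .
    qed
    \<comment> \<open>The comparison integrand freezes \<open>v\<close> at the right end and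
      \<open>u\<close> at the left end; its integral (u t - u s) v t + u s (v t - v s) is exactly
      the increment of u v. In the remainder each term is a product of two small quantities.\<close>
    have FF: "((\<lambda>r. h r - u1 r * v t - u s * g r) has_integral
       (integral {0..t} h - integral {0..s} h - (u t - u s) * v t - u s * (v t - v s))) {s..t}"
      by (intro has_integral_diff i1 has_integral_mult_left i3 has_integral_mult_right i4)
         (use st in auto)
    have FF': "integral {0..t} h - integral {0..s} h - (u t - u s) * v t - u s * (v t - v s)
       = F t - F s" by (simp add: F_def algebra_simps)
    have LL: "((\<lambda>r. L * (G t - G s) + L * (t - s) * norm (g r)) has_integral
       ((t - s) * (L * (G t - G s)) + L * (t - s) * (G t - G s))) {s..t}"
      using has_integral_const_real[of "L * (G t - G s)" s t] st
      by (intro has_integral_add has_integral_mult_right i2) simp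
    have "norm (h r - u1 r * v t - u s * g r) \<le> L * (G t - G s) + L * (t - s) * norm (g r)"
      if r: "r \<in> {s..t}" for r
    proof -
      have "h r - u1 r * v t - u s * g r = u1 r * (v r - v t) + (u r - u s) * g r"
        by (simp add: h_def algebra_simps)
      also have "norm \<dots> \<le> norm (u1 r) * norm (v r - v t) + norm (u r - u s) * norm (g r)"
        by (metis norm_mult norm_triangle_ineq)
      also have "\<dots> \<le> L * (G t - G s) + L * (t - s) * norm (g r)"
        using L[of r] vv[OF r] uu[OF r] L0 r sub G0
        by (intro add_mono mult_mono mult_right_mono) auto
      finally show ?thesis .
    qed
    from has_integral_norm_bound[OF FF[unfolded FF'] LL this] have "norm (F t - F s) \<le> (t - s) * (L * (G t - G s)) + L * (t - s) * (G t - G s)" .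
    then show ?thesis by (simp add: algebra_simps)
  qed
  have "F T = F 0" using increment_bound_imp_constant[OF cG _ key T] L0 by auto
  then have "integral {0..T} h = u T * v T - u 0 * v 0" by (simp add: F_def algebra_simps)
  moreover have "h integrable_on {0..T}" using hi T by (auto intro: integrable_on_subinterval)
  ultimately show ?thesis unfolding h_def by (auto simp: has_integral_iff)
qed

text \<open>The derivative is carried as a separate function, and y'' = V y is stated in integrated
  form. A general \<open>V\<close> covers both the equation and its complex conjugate.\<close>

definition weak_ode :: "(real \<Rightarrow> complex) \<Rightarrow> (real \<Rightarrow> complex) \<Rightarrow> (real \<Rightarrow> complex) \<Rightarrow> bool" where
  "weak_ode V y y1 \<longleftrightarrow>
     (\<forall>t\<in>{0..1}. (y has_vector_derivative y1 t) (at t within {0..1})) \<and>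
     (\<forall>t\<in>{0..1}. ((\<lambda>s. V s * y s) has_integral (y1 t - y1 0)) {0..t})"

lemma weak_ode_continuous:
  assumes "weak_ode V y y1"
  shows "continuous_on {0..1} y" "continuous_on {0..1} y1"
proof -
  show "continuous_on {0..1} y"
    by (rule continuous_on_vector_derivative[where f'=y1]) (use assms in \<open>auto simp: weak_ode_def\<close>)
  have vint: "y1 t = y1 0 + integral {0..t} (\<lambda>s. V s * y s)" if "t \<in> {0..1}" for t
    using assms that by (auto simp: weak_ode_def has_integral_iff)
  have "(\<lambda>s. V s * y s) integrable_on {0..1}" 
    using assms unfolding weak_ode_def by (meson atLeastAtMost_iff has_integral_integrable order_refl zero_le_one)
  then have "continuous_on {0..1} (\<lambda>t. y1 0 + integral {0..t} (\<lambda>s. V s * y s))"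
    by (intro continuous_intros indefinite_integral_continuous_1)
  then show "continuous_on {0..1} y1" by (rule continuous_on_eq) (rule vint[symmetric])
qed

text \<open>Subtracting two integrations by parts cancels \<open>f1 * g1\<close>. For
  \<open>U = V\<close> the Wronskian is constant; for the parameters \<mu> and
  \<open>cnj \<mu>\<close> this is the identity behind the reality of eigenvalues.\<close>

lemma weak_ode_wronskian:
  assumes f: "weak_ode V f f1" and g: "weak_ode U g g1"
    and V: "V absolutely_integrable_on {0..1}" and U: "U absolutely_integrable_on {0..1}"
    and t: "t \<in> {0..1}"
  shows "((\<lambda>s. (U s - V s) * (f s * g s)) has_integral
     ((f t * g1 t - f1 t * g t) - (f 0 * g1 0 - f1 0 * g 0))) {0..t}"
proof -
  note cf = weak_ode_continuous[OF f] and cg = weak_ode_continuous[OF g]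
  have "((\<lambda>s. f1 s * g1 s + f s * (U s * g s)) has_integral (f t * g1 t - f 0 * g1 0)) {0..t}"
    by (rule integration_by_parts_indefinite[OF _ cf(2) _ absolutely_integrable_mult_continuous[OF U cg(1)] t])
       (use f g in \<open>auto simp: weak_ode_def\<close>)
  moreover have "((\<lambda>s. g1 s * f1 s + g s * (V s * f s)) has_integral (g t * f1 t - g 0 * f1 0)) {0..t}"
    by (rule integration_by_parts_indefinite[OF _ cg(2) _ absolutely_integrable_mult_continuous[OF V cf(1)] t])
       (use f g in \<open>auto simp: weak_ode_def\<close>)
  ultimately have "((\<lambda>s. (f1 s * g1 s + f s * (U s * g s)) - (g1 s * f1 s + g s * (V s * f s)))
     has_integral ((f t * g1 t - f 0 * g1 0) - (g t * f1 t - g 0 * f1 0))) {0..t}"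
    by (rule has_integral_diff)
  then show ?thesis by (simp add: algebra_simps)
qed

lemma weak_ode_linear:
  assumes "weak_ode V f f1" "weak_ode V g g1"
  shows "weak_ode V (\<lambda>t. f t + c * g t) (\<lambda>t. f1 t + c * g1 t)"
  unfolding weak_ode_def
proof (intro conjI ballI)
  fix t :: real assume t: "t \<in> {0..1}"
  have "(f has_vector_derivative f1 t) (at t within {0..1})"
       "(g has_vector_derivative g1 t) (at t within {0..1})"
    using assms t by (auto simp: weak_ode_def)
  then show "((\<lambda>t. f t + c * g t) has_vector_derivative f1 t + c * g1 t) (at t within {0..1})"
    by (intro has_vector_derivative_add has_vector_derivative_mult_right)
  have "((\<lambda>s. V s * f s) has_integral (f1 t - f1 0)) {0..t}"
       "((\<lambda>s. V s * g s) has_integral (g1 t - g1 0)) {0..t}"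
    using assms t by (auto simp: weak_ode_def)
  then have "((\<lambda>s. V s * f s + c * (V s * g s)) has_integral (f1 t - f1 0) + c * (g1 t - g1 0)) {0..t}"
    by (intro has_integral_add has_integral_mult_right)
  then show "((\<lambda>s. V s * (f s + c * g s)) has_integral (f1 t + c * g1 t - (f1 0 + c * g1 0))) {0..t}"
    by (simp add: algebra_simps)
qed

lemma weak_ode_scale:
  assumes "weak_ode V f f1"
  shows "weak_ode V (\<lambda>t. c * f t) (\<lambda>t. c * f1 t)"
proof -
  have "weak_ode V (\<lambda>_. 0) (\<lambda>_. 0)" by (simp add: weak_ode_def)
  from weak_ode_linear[OF this assms] show ?thesis by simp
qed

lemma weak_ode_cnj:
  assumes "weak_ode V f f1"
  shows "weak_ode (\<lambda>t. cnj (V t)) (\<lambda>t. cnj (f t)) (\<lambda>t. cnj (f1 t))"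
  unfolding weak_ode_def
proof (intro conjI ballI)
  fix t :: real assume t: "t \<in> {0..1}"
  show "((\<lambda>t. cnj (f t)) has_vector_derivative cnj (f1 t)) (at t within {0..1})"
    using assms t by (auto simp: weak_ode_def intro: has_vector_derivative_cnj)
  have "((\<lambda>s. V s * f s) has_integral (f1 t - f1 0)) {0..t}"
    using assms t by (auto simp: weak_ode_def)
  then have "(cnj \<circ> (\<lambda>s. V s * f s) has_integral cnj (f1 t - f1 0)) {0..t}"
    by (simp only: has_integral_cnj)
  then show "((\<lambda>s. cnj (V s) * cnj (f s)) has_integral cnj (f1 t) - cnj (f1 0)) {0..t}"
    by (simp add: o_def)
qed

text \<open>The zero set of \<open>(y, y1)\<close> is closed, and open because a zero propagates over the fixed distance \<open>d\<close>.\<close>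

lemma weak_ode_unique:
  assumes y: "weak_ode V y y1" and V: "V absolutely_integrable_on {0..1}"
    and c: "c \<in> {0..1}" "y c = 0" "y1 c = 0" and t: "t \<in> {0..1}"
  shows "y t = 0" "y1 t = 0"
proof -
  note cy = weak_ode_continuous[OF y]
  define K where "K = integral {0..1} (\<lambda>s. norm (V s))"
  have Vn: "(\<lambda>s. norm (V s)) integrable_on {0..1}" using V by (auto simp: absolutely_integrable_on_def)
  have K0: "K \<ge> 0" unfolding K_def by (rule integral_nonneg[OF Vn]) auto
  \<comment> \<open>Within distance \<open>d\<close> of a common zero, the maximum M of |y|
    satisfies M \<le> K M d, because |y1| \<le> K M there. As \<open>K * d < 1\<close>, this forces
    M = 0; the summand 1 covers \<open>K = 0\<close>.\<close>
  define d where "d = 1 / (2 * (K + 1))"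
  have d0: "d > 0" and Kd: "K * d < 1" using K0 by (auto simp: d_def field_simps)
  have inc: "norm (y1 b - y1 a) \<le> K * M"
    if ab: "0 \<le> a" "a \<le> b" "b \<le> 1" and M: "M \<ge> 0" "\<And>s. s \<in> {a..b} \<Longrightarrow> norm (y s) \<le> M" for a b M
  proof -
    have i: "((\<lambda>s. V s * y s) has_integral (y1 b - y1 a)) {a..b}"
      by (rule has_integral_increment[OF _ ab]) (use y in \<open>auto simp: weak_ode_def\<close>)
    have j: "(\<lambda>s. norm (V s)) integrable_on {a..b}" using Vn ab by (auto intro: integrable_on_subinterval)
    have "norm (y1 b - y1 a) \<le> integral {a..b} (\<lambda>s. norm (V s) * M)"
      unfolding integral_unique[OF i, symmetric]
      by (rule integral_norm_bound_integral)
         (use i j M in \<open>auto simp: norm_mult intro!: mult_left_mono integrable_on_mult_left\<close>)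
    also have "\<dots> = integral {a..b} (\<lambda>s. norm (V s)) * M" by simp
    also have "\<dots> \<le> K * M" unfolding K_def
      by (intro mult_right_mono integral_subset_le j Vn) (use ab M in auto)
    finally show ?thesis .
  qed
  define Z where "Z = {t\<in>{0..1}. y t = 0 \<and> y1 t = 0}"
  have step: "s \<in> Z" if x: "x \<in> Z" and s: "s \<in> {0..1}" "dist s x \<le> d" for x s
  proof -
    define J where "J = {max 0 (x - d)..min 1 (x + d)}"
    have J: "J \<subseteq> {0..1}" "x \<in> J" "s \<in> J" using x s d0 by (auto simp: J_def Z_def dist_real_def)
    have "compact ((\<lambda>s. norm (y s)) ` J)"
      using J by (intro compact_continuous_image continuous_intros continuous_on_subset[OF cy(1)]) (auto simp: J_def)
    then obtain r where r: "r \<in> J" "\<And>s. s \<in> J \<Longrightarrow> norm (y s) \<le> norm (y r)"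
      using compact_attains_sup[of "(\<lambda>s. norm (y s)) ` J"] J by blast
    define M where "M = norm (y r)"
    have y1b: "norm (y1 b) \<le> K * M" if b: "b \<in> J" for b
    proof (cases "x \<le> b")
      case True
      have "norm (y1 b - y1 x) \<le> K * M"
        by (rule inc) (use True b J in \<open>auto simp: M_def J_def intro!: r(2)\<close>)
      then show ?thesis using x by (simp add: Z_def)
    next
      case False
      have "norm (y1 x - y1 b) \<le> K * M"
        by (rule inc) (use False b J in \<open>auto simp: M_def J_def intro!: r(2)\<close>)
      then show ?thesis using x by (simp add: Z_def)
    qed
    have "norm (y r - y x) \<le> K * M * norm (r - x)"
    proof (rule differentiable_bound[of J y "\<lambda>t h. h *\<^sub>R y1 t"])
      show "convex J" by (simp add: J_def)
      show "(y has_derivative (\<lambda>h. h *\<^sub>R y1 t)) (at t within J)" if "t \<in> J" for t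
      proof -
        have "(y has_vector_derivative y1 t) (at t within {0..1})" using y that J by (auto simp: weak_ode_def)
        then have "(y has_vector_derivative y1 t) (at t within J)"
          using J has_vector_derivative_within_subset by blast
        then show ?thesis by (simp add: has_vector_derivative_def)
      qed
      show "onorm (\<lambda>h. h *\<^sub>R y1 t) \<le> K * M" if "t \<in> J" for t
        using y1b[OF that] by (intro onorm_le) (simp add: mult.commute mult_left_mono)
    qed (use r J in auto)
    moreover have "norm (r - x) \<le> d" using r by (auto simp: J_def)
    moreover have "K * M \<ge> 0" using K0 by (simp add: M_def)
    ultimately have "M \<le> K * M * d" using x 
      by (smt (verit) M_def Z_def diff_zero mem_Collect_eq mult_left_mono)
    then have "(1 - K * d) * M \<le> 0" by (simp add: algebra_simps)
    then have "M \<le> 0" using Kd by (simp add: mult_le_0_iff)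
    then have "M = 0" by (simp add: M_def)
    then show ?thesis using r(2)[OF J(3)] y1b[OF J(3)] s by (auto simp: Z_def M_def)
  qed
  have "openin (top_of_set {0..1}) Z"
    unfolding openin_euclidean_subtopology_iff
  proof (intro conjI ballI)
    show "Z \<subseteq> {0..1}" by (auto simp: Z_def)
    show "\<exists>e>0. \<forall>s\<in>{0..1}. dist s x < e \<longrightarrow> s \<in> Z" if "x \<in> Z" for x
      using step[OF that] d0 by (meson less_imp_le)
  qed
  moreover have "closedin (top_of_set {0..1}) Z"
  proof -
    have "Z = {0..1} \<inter> (\<lambda>t. (y t, y1 t)) -` {(0, 0)}" by (auto simp: Z_def)
    also have "closedin (top_of_set {0..1}) \<dots>"
      by (intro continuous_closedin_preimage continuous_intros cy)
    finally show ?thesis .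
  qed
  moreover have "Z \<noteq> {}" using c by (auto simp: Z_def)
  ultimately have "Z = {0..1}" using connected_clopen[of "{0..1::real}"] connected_Icc by blast
  with t have "t \<in> Z" by simp
  then show "y t = 0" "y1 t = 0" by (auto simp: Z_def)
qed

section \<open>Square-summable solutions of the Kirchhoff system\<close>

lemma l2_seq_add:
  assumes "l2_seq x" "l2_seq y"
  shows "l2_seq (\<lambda>n. x n + y n)"
  unfolding l2_seq_def
proof (rule summable_on_comparison_test)
  show "(\<lambda>n. 2 * (cmod (x n))\<^sup>2 + 2 * (cmod (y n))\<^sup>2) summable_on UNIV"
    using assms unfolding l2_seq_def by (intro summable_on_add summable_on_cmult_right)
  fix n
  have "(cmod (x n + y n))\<^sup>2 \<le> (cmod (x n) + cmod (y n))\<^sup>2"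
    by (intro power_mono norm_triangle_ineq) auto
  also have "\<dots> \<le> 2 * (cmod (x n))\<^sup>2 + 2 * (cmod (y n))\<^sup>2"
    using sum_squares_bound[of "cmod (x n)" "cmod (y n)"] by (simp add: power2_sum)
  finally show "(cmod (x n + y n))\<^sup>2 \<le> 2 * (cmod (x n))\<^sup>2 + 2 * (cmod (y n))\<^sup>2" .
qed auto

lemma l2_seq_cmult:
  assumes "l2_seq x"
  shows "l2_seq (\<lambda>n. c * x n)"
proof -
  have "(\<lambda>n. (cmod c)\<^sup>2 * (cmod (x n))\<^sup>2) summable_on UNIV"
    using assms unfolding l2_seq_def by (rule summable_on_cmult_right)
  then show ?thesis by (simp add: l2_seq_def norm_mult power_mult_distrib)
qed

lemma l2_seq_shift:
  assumes "l2_seq x"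
  shows "l2_seq (\<lambda>n. x (n - m))"
proof -
  have "bij_betw (\<lambda>n. n - m) UNIV (UNIV :: int set)"
    by (rule bij_betwI[where g="\<lambda>n. n + m"]) auto
  from summable_on_reindex_bij_betw[OF this, of "\<lambda>n. (cmod (x n))\<^sup>2"] assms
  show ?thesis by (simp add: l2_seq_def)
qed

lemma l2_seq_delta: "l2_seq (\<lambda>n. if n = m then c else 0)"
proof -
  have "(\<lambda>n. (cmod (if n = m then c else 0))\<^sup>2) summable_on {m}" by simp
  then show ?thesis unfolding l2_seq_def
    by (subst summable_on_cong_neutral[where T="{m}"]) auto
qed

lemma l2_seq_invariant_imp_zero:
  assumes inv: "\<And>n. x n = x (n - 1)" and l2: "l2_seq x"
  shows "x n = 0"
proof -
  have const: "x n = x 0" for n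
  proof (induction n rule: int_induct[where k=0])
    case (step1 i) then show ?case using inv[of "i + 1"] by simp
  next
    case (step2 i) then show ?case using inv[of i] by simp
  qed simp
  then have "x = (\<lambda>n. x 0)" by blast
  with l2 have "l2_seq (\<lambda>n. x 0)" by simp
  then have "(\<lambda>n::int. (cmod (x 0))\<^sup>2) summable_on UNIV" by (simp only: l2_seq_def)
  then have "(cmod (x 0))\<^sup>2 = 0" using infsum_diverge_constant[OF infinite_UNIV_int] by blast
  then have "x 0 = 0" by simp
  then show ?thesis using const by simp
qed

text \<open>\<open>A n j\<close> is the derivative at \<open>0\<close> on edge \<open>(n,j)\<close> and \<open>p A n j\<close> the one at \<open>1\<close>; the parameters
  stand for \<open>e1 = e\<^sup>i\<^sup>a\<^sup>1\<close>, \<open>i1 = 1/e1\<close>, \<open>e2 = e\<^sup>i\<^sup>a\<^sup>2\<close>, \<open>z = s\<^sup>k\<close>.\<close>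

definition currents :: "complex \<Rightarrow> complex \<Rightarrow> complex \<Rightarrow> complex \<Rightarrow> complex \<Rightarrow> (int \<Rightarrow> nat \<Rightarrow> complex) \<Rightarrow> bool" where
  "currents e1 i1 e2 z p A \<longleftrightarrow> (\<forall>n.
     e1 * (p * A n 1) - A n 2 - A n 5 = 0 \<and>
     e2 * (p * A n 2) - A n 3 - A n 6 = 0 \<and>
     e1 * (p * A n 3) - A n 4 + e1 * (p * A (n - 1) 6) = 0 \<and>
     e2 * z * (p * A n 4) - A n 1 + i1 * (p * A (n - 1) 5) = 0)"

text \<open>The coefficient formulas as functions of the initial slopes alone: \<open>b\<close>
  marks the degenerate case and \<open>K\<close> is the product of the kappas. With abstract
  parameters all identities become polynomial ones, free of trigonometry.\<close>

definition edge_coef :: "bool \<Rightarrow> complex \<Rightarrow> complex \<Rightarrow> complex \<Rightarrow> complex \<Rightarrow> complex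
    \<Rightarrow> (int \<Rightarrow> nat \<Rightarrow> complex) \<Rightarrow> int \<Rightarrow> nat \<Rightarrow> complex" where
  "edge_coef b e1 e2 z p K A n \<nu> =
     (if b then (if \<nu> = 1 then A n 1 else A n 2)
      else if \<nu> = 1 then (A n 5 + z * p * (e1 * e2 * e1) * A n 6) / K
      else - (e1 * A n 6 + p * (e1 * e2) * A n 5) / K)"

text \<open>\<open>\<alpha> j \<nu>\<close> and \<open>\<beta> j \<nu>\<close> are the amplitudes of the basic eigenfunction \<open>\<psi>\<^sup>(\<^sup>0\<^sup>,\<^sup>\<nu>\<^sup>)\<close> on edge \<open>j\<close> of
  the cells \<open>0\<close> and \<open>1\<close>.\<close>

definition two_term :: "(nat \<Rightarrow> nat \<Rightarrow> complex) \<Rightarrow> (nat \<Rightarrow> nat \<Rightarrow> complex) \<Rightarrow> (int \<Rightarrow> nat \<Rightarrow> complex)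
    \<Rightarrow> int \<Rightarrow> nat \<Rightarrow> complex" where
  "two_term \<alpha> \<beta> h n j = \<alpha> j 1 * h n 1 + \<alpha> j 2 * h n 2 + \<beta> j 1 * h (n - 1) 1 + \<beta> j 2 * h (n - 1) 2"

lemma l2_seq_two_term:
  assumes "l2_seq (\<lambda>n. h n 1)" "l2_seq (\<lambda>n. h n 2)"
  shows "l2_seq (\<lambda>n. two_term \<alpha> \<beta> h n j)"
  unfolding two_term_def
  using assms l2_seq_shift[OF assms(1), of 1] l2_seq_shift[OF assms(2), of 1]
  by (intro l2_seq_add l2_seq_cmult)

lemma ball_one_to_six: "(\<forall>j\<in>{1..6::nat}. P j) \<longleftrightarrow> P 1 \<and> P 2 \<and> P 3 \<and> P 4 \<and> P 5 \<and> P 6"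
proof -
  have "{1..6::nat} = {1,2,3,4,5,6}" by auto
  then show ?thesis by simp
qed

text \<open>The cycle factor \<open>z * (e1 * e2)\<^sup>2 * p ^ 4\<close> is 1, so edge 1 drops out
  when the equations are composed around the cycle. What is left is a constraint on edges 5 and 6
  saying that one combination of them is the same in all cells.\<close>

lemma currents_parametrization_degenerate:
  assumes e1: "e1 * i1 = 1" and ze: "z * (e1 * e2)\<^sup>2 = 1" and p: "p\<^sup>2 = 1"
  obtains \<alpha> \<beta> where
    "\<And>h. currents e1 i1 e2 z p (two_term \<alpha> \<beta> h)"
    "\<And>h n \<nu>. \<nu> \<in> {1,2} \<Longrightarrow> edge_coef True e1 e2 z p K (two_term \<alpha> \<beta> h) n \<nu> = h n \<nu>"
    "\<And>A n j. currents e1 i1 e2 z p A \<Longrightarrow> (\<And>j. j \<in> {1..6} \<Longrightarrow> l2_seq (\<lambda>n. A n j)) \<Longrightarrow> j \<in> {1..6} \<Longrightarrow>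
       A n j = two_term \<alpha> \<beta> (edge_coef True e1 e2 z p K A) n j"
proof -
  define e where "e = e1 * e2"
  \<comment> \<open>Edges 1 and 2 are prescribed. The first Kirchhoff equation gives edge 5, the
    vanishing invariant gives edge 6, the second equation gives edge 3 and the third gives edge 4,
    the only one that sees the previous cell. The leading 0 pads the lists because edges are
    numbered from 1.\<close>
  define \<alpha> where "\<alpha> = (\<lambda>j \<nu>::nat. (if \<nu> = 1 then [0, 1, 0, e, e1 * e * p, e1 * p, - e]
                                    else [0, 0, 1, 0, 0, - 1, e2 * p]) ! j)"
  define \<beta> where "\<beta> = (\<lambda>j \<nu>::nat. (if \<nu> = 1 then [0, 0, 0, 0, - (e1 * e * p), 0, 0]
                                    else [0, 0, 0, 0, e, 0, 0]) ! j)"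
  have T: "two_term \<alpha> \<beta> h n 1 = h n 1" "two_term \<alpha> \<beta> h n 2 = h n 2"
    "two_term \<alpha> \<beta> h n 3 = e * h n 1"
    "two_term \<alpha> \<beta> h n 4 = e1 * e * p * h n 1 - e1 * e * p * h (n - 1) 1 + e * h (n - 1) 2"
    "two_term \<alpha> \<beta> h n 5 = e1 * p * h n 1 - h n 2"
    "two_term \<alpha> \<beta> h n 6 = - e * h n 1 + e2 * p * h n 2" for h n
    by (simp_all add: two_term_def \<alpha>_def \<beta>_def)
  show ?thesis
  proof (rule that[of \<alpha> \<beta>])
    show "currents e1 i1 e2 z p (two_term \<alpha> \<beta> h)" for h
      unfolding currents_def T
    proof (intro allI conjI)
      fix n
      show "e1 * (p * h n 1) - h n 2 - (e1 * p * h n 1 - h n 2) = 0" by (simp add: algebra_simps)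
      show "e2 * (p * h n 2) - e * h n 1 - (- e * h n 1 + e2 * p * h n 2) = 0" by (simp add: algebra_simps)
      show "e1 * (p * (e * h n 1))
          - (e1 * e * p * h n 1 - e1 * e * p * h (n - 1) 1 + e * h (n - 1) 2)
          + e1 * (p * (- e * h (n - 1) 1 + e2 * p * h (n - 1) 2)) = 0"
        using p unfolding e_def by algebra
      show "e2 * z * (p * (e1 * e * p * h n 1 - e1 * e * p * h (n - 1) 1 + e * h (n - 1) 2)) - h n 1 +
         i1 * (p * (e1 * p * h (n - 1) 1 - h (n - 1) 2)) = 0"
        using p ze e1 unfolding e_def by algebra
    qed
    show "edge_coef True e1 e2 z p K (two_term \<alpha> \<beta> h) n \<nu> = h n \<nu>" if "\<nu> \<in> {1,2}" for h n \<nu>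
      using that T(1,2)[of h n] by (auto simp: edge_coef_def)
    show "A n j = two_term \<alpha> \<beta> (edge_coef True e1 e2 z p K A) n j"
      if A: "currents e1 i1 e2 z p A" and l2: "\<And>j. j \<in> {1..6} \<Longrightarrow> l2_seq (\<lambda>n. A n j)"
        and j: "j \<in> {1..6}" for A n j
    proof -
      have c: "e1 * (p * A n 1) - A n 2 - A n 5 = 0" "e2 * (p * A n 2) - A n 3 - A n 6 = 0"
          "e1 * (p * A n 3) - A n 4 + e1 * (p * A (n - 1) 6) = 0"
          "e2 * z * (p * A n 4) - A n 1 + i1 * (p * A (n - 1) 5) = 0" for n
        using A by (auto simp: currents_def)
      \<comment> \<open>This is the combination that survives the elimination of edges 1 to
        4.\<close>
      define x where "x = (\<lambda>n. e2 * p * A n 5 + A n 6)"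
      have "x n = x (n - 1)" for n
        using c[of n] e1 ze p unfolding x_def by algebra
      moreover have "l2_seq x" unfolding x_def by (intro l2_seq_add l2_seq_cmult l2) auto
      ultimately have x0: "x n = 0" for n by (rule l2_seq_invariant_imp_zero)
      have h: "edge_coef True e1 e2 z p K A n 1 = A n 1" "edge_coef True e1 e2 z p K A n 2 = A n 2" for n
        by (simp_all add: edge_coef_def)
      have "\<forall>j\<in>{1..6}. A n j = two_term \<alpha> \<beta> (edge_coef True e1 e2 z p K A) n j"
        unfolding ball_one_to_six T h
      proof (intro conjI refl)
        note c1 = c[of n] and c2 = c[of "n - 1"] and x1 = x0[of n, unfolded x_def] and x2 = x0[of "n - 1", unfolded x_def]
        show a5: "A n 5 = e1 * p * A n 1 - A n 2" using c1(1) by algebra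
        show a6: "A n 6 = - e * A n 1 + e2 * p * A n 2" using c1(1) x1 p unfolding e_def by algebra
        show a3: "A n 3 = e * A n 1" using c1(2) a6 by algebra
        show "A n 4 = e1 * e * p * A n 1 - e1 * e * p * A (n - 1) 1 + e * A (n - 1) 2"
          using c1(3) a3 x2 c2(1) p unfolding e_def by algebra
      qed
      then show ?thesis using j by blast
    qed
  qed
qed

text \<open>Since \<open>k2\<close> is nonzero, edges 5 and 6 of the cells n and n - 1 determine the
  cycle of cell n. The numerators of the coefficients form a linear map of these two slopes with
  determinant \<open>- e1 * k1\<close>, hence invertible.\<close>

lemma currents_parametrization_generic:
  assumes e1: "e1 * i1 = 1"
    and k1: "k1 = 1 - z * (e1 * e2)\<^sup>2 * p\<^sup>2" "k1 \<noteq> 0"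
    and k2: "k2 = 1 - z * (e1 * e2)\<^sup>2 * p ^ 4" "k2 \<noteq> 0"
  obtains \<alpha> \<beta> where
    "\<And>h. currents e1 i1 e2 z p (two_term \<alpha> \<beta> h)"
    "\<And>h n \<nu>. \<nu> \<in> {1,2} \<Longrightarrow> edge_coef False e1 e2 z p (k1 * k2) (two_term \<alpha> \<beta> h) n \<nu> = h n \<nu>"
    "\<And>A n j. currents e1 i1 e2 z p A \<Longrightarrow> j \<in> {1..6} \<Longrightarrow>
       A n j = two_term \<alpha> \<beta> (edge_coef False e1 e2 z p (k1 * k2) A) n j"
proof -
  define e where "e = e1 * e2"
  \<comment> \<open>Inverting the coefficient map costs 1/k1 and solving the cycle costs 1/k2; both
    are absorbed by the factor \<open>k1 * k2\<close>. The terms in \<open>h (n - 1)\<close> become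
    \<open>\<beta>\<close>, which is why the support reaches into cell 1.\<close>
  define \<alpha> where "\<alpha> = (\<lambda>j \<nu>::nat. (if \<nu> = 1 then [0, 0, - k2, 0, 0, k2, - (i1 * k2 * p * e)]
       else [0, k1 * e2 * z * p\<^sup>2, z * p * e * (p\<^sup>2 - 1), k1 * i1, k1 * p, k2 * z * p * e, - (i1 * k2)]) ! j)"
  define \<beta> where "\<beta> = (\<lambda>j \<nu>::nat. (if \<nu> = 1 then
       [0, k1 * i1 * p, k1 * p\<^sup>2, k1 * e2 * p ^ 3, p\<^sup>2 * (p\<^sup>2 - 1) * e, 0, 0]
       else [0, 0, 0, 0, - (k2 * p), 0, 0]) ! j)"
  have T: "two_term \<alpha> \<beta> h n 1 = k1 * e2 * z * p\<^sup>2 * h n 2 + k1 * i1 * p * h (n - 1) 1"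
    "two_term \<alpha> \<beta> h n 2 = z * p * e * (p\<^sup>2 - 1) * h n 2 - k2 * h n 1 + k1 * p\<^sup>2 * h (n - 1) 1"
    "two_term \<alpha> \<beta> h n 3 = k1 * i1 * h n 2 + k1 * e2 * p ^ 3 * h (n - 1) 1"
    "two_term \<alpha> \<beta> h n 4 = k1 * p * h n 2 - k2 * p * h (n - 1) 2 + p\<^sup>2 * (p\<^sup>2 - 1) * e * h (n - 1) 1"
    "two_term \<alpha> \<beta> h n 5 = k2 * h n 1 + k2 * z * p * e * h n 2"
    "two_term \<alpha> \<beta> h n 6 = - (i1 * k2 * p * e * h n 1) - i1 * k2 * h n 2" for h n
    by (simp_all add: two_term_def \<alpha>_def \<beta>_def)
  show ?thesis
  proof (rule that[of \<alpha> \<beta>])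
    show "currents e1 i1 e2 z p (two_term \<alpha> \<beta> h)" for h
      unfolding currents_def T
      using e1 k1(1) k2(1) e_def by (intro allI conjI; algebra)
    show "edge_coef False e1 e2 z p (k1 * k2) (two_term \<alpha> \<beta> h) n \<nu> = h n \<nu>" if "\<nu> \<in> {1,2}" for h n \<nu>
    proof -
      have "two_term \<alpha> \<beta> h n 5 + z * p * (e1 * e2 * e1) * two_term \<alpha> \<beta> h n 6 = k1 * k2 * h n 1"
        unfolding T using e1 k1(1) e_def by algebra
      moreover have "- (e1 * two_term \<alpha> \<beta> h n 6 + p * (e1 * e2) * two_term \<alpha> \<beta> h n 5) = k1 * k2 * h n 2"
        unfolding T using e1 k1(1) e_def by algebra
      ultimately show ?thesis using that k1(2) k2(2) by (auto simp: edge_coef_def)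
    qed
    show "A n j = two_term \<alpha> \<beta> (edge_coef False e1 e2 z p (k1 * k2) A) n j"
      if A: "currents e1 i1 e2 z p A" and j: "j \<in> {1..6}" for A n j
    proof -
      have c: "e1 * (p * A n 1) - A n 2 - A n 5 = 0" "e2 * (p * A n 2) - A n 3 - A n 6 = 0"
          "e1 * (p * A n 3) - A n 4 + e1 * (p * A (n - 1) 6) = 0"
          "e2 * z * (p * A n 4) - A n 1 + i1 * (p * A (n - 1) 5) = 0" for n
        using A by (auto simp: currents_def)
      define h where "h = edge_coef False e1 e2 z p (k1 * k2) A"
      have h: "k1 * k2 * h n 1 = A n 5 + z * p * (e1 * e2 * e1) * A n 6"
         "k1 * k2 * h n 2 = - (e1 * A n 6 + p * (e1 * e2) * A n 5)" for n
        using k1(2) k2(2) by (simp_all add: h_def edge_coef_def)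
      have a5: "A n 5 = k2 * h n 1 + k2 * z * p * e * h n 2" for n
      proof -
        have "k1 * A n 5 = k1 * (k2 * h n 1 + k2 * z * p * e * h n 2)"
          using h[of n] k1(1) e_def by algebra
        then show ?thesis using k1(2) by simp
      qed
      have a6: "A n 6 = - (i1 * k2 * p * e * h n 1) - i1 * k2 * h n 2" for n
      proof -
        have "k1 * A n 6 = k1 * (- (i1 * k2 * p * e * h n 1) - i1 * k2 * h n 2)"
          using h[of n] k1(1) e_def e1 by algebra
        then show ?thesis using k1(2) by simp
      qed
      have a1: "A n 1 = k1 * e2 * z * p\<^sup>2 * h n 2 + k1 * i1 * p * h (n - 1) 1" for n
      proof -
        \<comment> \<open>The four equations of cell n composed around the cycle: edge 1 returns to
          itself with the factor \<open>z * (e1 * e2)\<^sup>2 * p ^ 4\<close>, apart from the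
          contributions of edges 5 and 6.\<close>
        have "k2 * A n 1 = i1 * (p * A (n - 1) 5) + e1 * e2 * z * p\<^sup>2 * (A (n - 1) 6 - A n 6)
           - e1 * e2 * e2 * z * p ^ 3 * A n 5"
          using c[of n] k2(1) by algebra
        also have "\<dots> = k2 * (k1 * e2 * z * p\<^sup>2 * h n 2 + k1 * i1 * p * h (n - 1) 1)"
          unfolding a5 a6 using k1(1) e_def e1 by algebra
        finally show ?thesis using k2(2) by simp
      qed
      have "\<forall>j\<in>{1..6}. A n j = two_term \<alpha> \<beta> h n j"
        unfolding ball_one_to_six T
      proof (intro conjI)
        show "A n 1 = k1 * e2 * z * p\<^sup>2 * h n 2 + k1 * i1 * p * h (n - 1) 1" by (rule a1)
        have "A n 2 = e1 * (p * A n 1) - A n 5" using c(1)[of n] by algebra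
        then show a2: "A n 2 = z * p * e * (p\<^sup>2 - 1) * h n 2 - k2 * h n 1 + k1 * p\<^sup>2 * h (n - 1) 1"
          unfolding a1 a5 using k1(1) k2(1) e_def e1 by algebra
        have "A n 3 = e2 * (p * A n 2) - A n 6" using c(2)[of n] by algebra
        then show a3: "A n 3 = k1 * i1 * h n 2 + k1 * e2 * p ^ 3 * h (n - 1) 1"
          unfolding a2 a6 using k1(1) k2(1) e_def e1 by algebra
        have "A n 4 = e1 * (p * A n 3) + e1 * (p * A (n - 1) 6)" using c(3)[of n] by algebra
        then show "A n 4 = k1 * p * h n 2 - k2 * p * h (n - 1) 2 + p\<^sup>2 * (p\<^sup>2 - 1) * e * h (n - 1) 1"
          unfolding a3 a6 using k1(1) k2(1) e_def e1 by algebra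
      qed (rule a5 a6)+
      then show ?thesis using j unfolding h_def by blast
    qed
  qed
qed

section \<open>The Dirichlet eigenfunction\<close>

abbreviation potential :: "(real \<Rightarrow> real) \<Rightarrow> complex \<Rightarrow> real \<Rightarrow> complex" where
  "potential q \<mu> \<equiv> (\<lambda>t. complex_of_real (q t) - \<mu>)"

lemma sl_sol_iff_weak_ode: "sl_sol q \<mu> y \<longleftrightarrow> (\<exists>y1. weak_ode (potential q \<mu>) y y1)"
  by (simp add: sl_sol_def has_d2_def weak_ode_def)

lemma weak_ode_imp_d01:
  assumes "weak_ode V y y1" "t \<in> {0..1}"
  shows "d01 y t = y1 t"
  unfolding d01_def
  by (rule vector_derivative_within_closed_interval) (use assms in \<open>auto simp: weak_ode_def\<close>)

lemma weak_ode_d01: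
  assumes "weak_ode V y y1"
  shows "weak_ode V y (d01 y)"
  using assms weak_ode_imp_d01[OF assms] by (simp add: weak_ode_def)

section \<open>Measurability and integrability with a square-integrable potential\<close>

lemma measurable_on_unit_interval_iff:
  fixes f :: "real \<Rightarrow> 'a::euclidean_space"
  shows "f measurable_on {0..1} \<longleftrightarrow> f \<in> borel_measurable (lebesgue_on {0..1})"
  by (rule measurable_on_iff_borel_measurable) simp

lemma potential_measurable:
  assumes "q measurable_on {0..1}"
  shows "potential q \<mu> \<in> borel_measurable (lebesgue_on {0..1})"
proof -
  have "q \<in> borel_measurable (lebesgue_on {0..1})"
    using assms by (simp add: measurable_on_unit_interval_iff)
  then show ?thesis by measurable
qed

lemma potential_absolutely_integrable:
  assumes q: "q measurable_on {0..1}" "(\<lambda>t. (q t)\<^sup>2) integrable_on {0..1}"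
  shows "potential q \<mu> absolutely_integrable_on {0..1}"
proof (rule measurable_bounded_by_integrable_imp_absolutely_integrable[OF potential_measurable[OF q(1)]])
  show "(\<lambda>t. (q t)\<^sup>2 + (1 + cmod \<mu>)) integrable_on {0..1}"
    by (intro integrable_add[OF q(2)]) (rule integrable_const_ivl)
  fix t :: real assume "t \<in> {0..1}"
  have "cmod (potential q \<mu> t) \<le> \<bar>q t\<bar> + cmod \<mu>"
    using norm_triangle_ineq4[of "complex_of_real (q t)" \<mu>] by simp
  also have "\<bar>q t\<bar> \<le> (q t)\<^sup>2 + 1"
    using sum_squares_bound[of "\<bar>q t\<bar>" 1] abs_ge_zero[of "q t"] by (simp add: power2_eq_square del: abs_ge_zero)
  finally show "cmod (potential q \<mu> t) \<le> (q t)\<^sup>2 + (1 + cmod \<mu>)" by simp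
qed auto

lemma sq_int01_continuous:
  assumes "continuous_on {0..1} y"
  shows "sq_int01 y"
  unfolding sq_int01_def
proof
  have "y \<in> borel_measurable (lebesgue_on {0..1})"
    by (rule continuous_imp_measurable_on_sets_lebesgue[OF assms]) auto
  then show "y measurable_on {0..1}" by (simp add: measurable_on_unit_interval_iff)
  show "(\<lambda>t. (cmod (y t))\<^sup>2) integrable_on {0..1}"
    by (intro integrable_continuous_real continuous_intros assms)
qed

lemma sq_int01_cmult:
  assumes "sq_int01 y"
  shows "sq_int01 (\<lambda>t. c * y t)"
  using assms unfolding sq_int01_def norm_mult power_mult_distrib measurable_on_unit_interval_iff
  by (auto intro: integrable_on_mult_right)

lemma sq_int01_cong:
  assumes "sq_int01 y" "\<And>t. t \<in> {0..1} \<Longrightarrow> x t = y t"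
  shows "sq_int01 x"
  unfolding sq_int01_def
proof
  show "x measurable_on {0..1}"
    by (rule measurable_on_spike[of y "{0..1}" "{}"]) (use assms in \<open>auto simp: sq_int01_def\<close>)
  show "(\<lambda>t. (cmod (x t))\<^sup>2) integrable_on {0..1}"
    using assms integrable_cong[of "{0..1}" "\<lambda>t. (cmod (x t))\<^sup>2" "\<lambda>t. (cmod (y t))\<^sup>2"] by (simp add: sq_int01_def)
qed

lemma sq_int01_potential_mult:
  assumes q: "q measurable_on {0..1}" "(\<lambda>t. (q t)\<^sup>2) integrable_on {0..1}"
    and y: "continuous_on {0..1} y"
  shows "sq_int01 (\<lambda>t. potential q \<mu> t * y t)"
  unfolding sq_int01_def
proof
  have ym: "y \<in> borel_measurable (lebesgue_on {0..1})"
    by (rule continuous_imp_measurable_on_sets_lebesgue[OF y]) auto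
  then have m: "(\<lambda>t. potential q \<mu> t * y t) \<in> borel_measurable (lebesgue_on {0..1})"
    using potential_measurable[OF q(1)] by measurable
  then show "(\<lambda>t. potential q \<mu> t * y t) measurable_on {0..1}"
    by (simp add: measurable_on_unit_interval_iff)
  have "bounded (y ` {0..1})" by (intro compact_imp_bounded compact_continuous_image y) auto
  then obtain M where M: "\<And>t. t \<in> {0..1} \<Longrightarrow> cmod (y t) \<le> M" unfolding bounded_iff by blast
  show "(\<lambda>t. (cmod (potential q \<mu> t * y t))\<^sup>2) integrable_on {0..1}"
  proof (rule measurable_bounded_by_integrable_imp_integrable_real)
    show "(\<lambda>t. (cmod (potential q \<mu> t * y t))\<^sup>2) \<in> borel_measurable (lebesgue_on {0..1})"
      using m by measurable
    show "(\<lambda>t. (2 * (q t)\<^sup>2 + 2 * (cmod \<mu>)\<^sup>2) * M\<^sup>2) integrable_on {0..1}"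
      by (intro integrable_on_mult_left integrable_add integrable_on_mult_right q(2)) (rule integrable_const_ivl)
    fix t :: real assume t: "t \<in> {0..1}"
    have "(cmod (potential q \<mu> t))\<^sup>2 \<le> (\<bar>q t\<bar> + cmod \<mu>)\<^sup>2"
      using norm_triangle_ineq4[of "complex_of_real (q t)" \<mu>] by (intro power_mono) auto
    also have "\<dots> \<le> 2 * (q t)\<^sup>2 + 2 * (cmod \<mu>)\<^sup>2"
      using sum_squares_bound[of "\<bar>q t\<bar>" "cmod \<mu>"] by (simp add: power2_sum)
    finally show "\<bar>(cmod (potential q \<mu> t * y t))\<^sup>2\<bar> \<le> (2 * (q t)\<^sup>2 + 2 * (cmod \<mu>)\<^sup>2) * M\<^sup>2"
      using M[OF t] by (auto simp: norm_mult power_mult_distrib intro!: mult_mono power_mono)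
  qed auto
qed

text \<open>The conjugate of \<open>y\<close> solves the equation for \<open>cnj \<mu>\<close>, and
  the boundary terms of the Wronskian vanish, so (\<mu> - cnj \<mu>) times the squared norm of
  \<open>y\<close> is 0.\<close>

lemma dirichlet_eigenvalue_real:
  assumes V: "\<And>\<mu>. potential q \<mu> absolutely_integrable_on {0..1}"
    and y: "weak_ode (potential q \<mu>) y y1" "y 0 = 0" "y 1 = 0" "\<exists>t\<in>{0..1}. y t \<noteq> 0"
  shows "cnj \<mu> = \<mu>"
proof -
  have y': "weak_ode (potential q (cnj \<mu>)) (\<lambda>t. cnj (y t)) (\<lambda>t. cnj (y1 t))"
    using weak_ode_cnj[OF y(1)] by simp
  have c: "continuous_on {0..1} (\<lambda>s. (cmod (y s))\<^sup>2)"
    by (intro continuous_intros weak_ode_continuous[OF y(1)])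
  define I where "I = integral {0..1} (\<lambda>s. (cmod (y s))\<^sup>2)"
  have "I \<noteq> 0" unfolding I_def using integral_eq_0_iff[OF c] y(4) by auto
  have "((\<lambda>s. (\<mu> - cnj \<mu>) * (y s * cnj (y s))) has_integral 0) {0..1}"
    using weak_ode_wronskian[OF y(1) y' V V, of 1] y(2,3) by simp
  moreover have "((\<lambda>s. (\<mu> - cnj \<mu>) * complex_of_real ((cmod (y s))\<^sup>2)) has_integral (\<mu> - cnj \<mu>) * complex_of_real I) {0..1}"
    unfolding I_def
    by (intro has_integral_mult_right has_integral_of_real integrable_integral integrable_continuous_real c)
  ultimately have "(\<mu> - cnj \<mu>) * complex_of_real I = 0"
    unfolding complex_norm_square[symmetric] by (metis has_integral_unique)
  then show ?thesis using \<open>I \<noteq> 0\<close> by simp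
qed

text \<open>A Dirichlet eigenfunction has nonzero slope at 0 by uniqueness; rescaling it yields
  \<phi>(t,\<mu>) without a general existence theorem. Uniqueness also makes the description in
  \<open>phi_d1\<close> well defined, and applied at the endpoint 1 it shows that the value is
  nonzero. It is real because the conjugate of \<open>w\<close> solves the same initial value
  problem.\<close>

lemma dirichlet_eigenfunction:
  assumes q: "q measurable_on {0..1}" "(\<lambda>t. (q t)\<^sup>2) integrable_on {0..1}"
    and mu: "\<mu> \<in> dir_spec q"
  obtains w w1 where "weak_ode (potential q \<mu>) w w1" "w 0 = 0" "w1 0 = 1" "w 1 = 0"
    "w1 1 = phi_d1 q \<mu>" "phi_d1 q \<mu> \<noteq> 0" "cnj (phi_d1 q \<mu>) = phi_d1 q \<mu>"
proof -
  note V = potential_absolutely_integrable[OF q]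
  obtain y y1 where y: "weak_ode (potential q \<mu>) y y1" "y 0 = 0" "y 1 = 0" "\<exists>t\<in>{0..1}. y t \<noteq> 0"
    using mu unfolding dir_spec_def sl_sol_iff_weak_ode by blast
  have "y1 0 \<noteq> 0" using weak_ode_unique(1)[OF y(1) V, of 0] y by auto
  define w where "w = (\<lambda>t. inverse (y1 0) * y t)"
  define w1 where "w1 = (\<lambda>t. inverse (y1 0) * y1 t)"
  have w: "weak_ode (potential q \<mu>) w w1" unfolding w_def w1_def by (rule weak_ode_scale[OF y(1)])
  have w0: "w 0 = 0" "w1 0 = 1" "w 1 = 0" using y \<open>y1 0 \<noteq> 0\<close> by (auto simp: w_def w1_def)
  have uniq: "x1 1 = w1 1" if "weak_ode (potential q \<mu>) x x1" "x 0 = 0" "x1 0 = 1" for x x1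
    using weak_ode_unique(2)[OF weak_ode_linear[OF that(1) w, of "-1"] V, of 0 1] that w0 by simp
  have phi: "phi_d1 q \<mu> = w1 1" unfolding phi_d1_def sl_sol_iff_weak_ode
  proof (rule the_equality)
    show "\<exists>y. (\<exists>y1. weak_ode (potential q \<mu>) y y1) \<and> y 0 = 0 \<and> d01 y 0 = 1 \<and> d01 y 1 = w1 1"
      using w w0 weak_ode_imp_d01[OF w] by (intro exI[of _ w]) auto
    show "c = w1 1" if "\<exists>y. (\<exists>y1. weak_ode (potential q \<mu>) y y1) \<and> y 0 = 0 \<and> d01 y 0 = 1 \<and> d01 y 1 = c" for c
      using that uniq weak_ode_d01 by metis
  qed
  have "w1 1 \<noteq> 0" using weak_ode_unique(2)[OF w V, of 1 0] w0 by auto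
  moreover have "cnj (w1 1) = w1 1"
  proof -
    have "cnj \<mu> = \<mu>" by (rule dirichlet_eigenvalue_real[OF V y])
    then have "weak_ode (potential q \<mu>) (\<lambda>t. cnj (w t)) (\<lambda>t. cnj (w1 t))"
      using weak_ode_cnj[OF w] by simp
    from uniq[OF this] show ?thesis using w0 by simp
  qed
  ultimately show ?thesis using that[OF w w0] phi by simp
qed

text \<open>The integral of (g - m)^2, with m the mean of \<open>g\<close> over the unit interval,
  is nonnegative.\<close>

lemma square_integral_le:
  fixes g :: "real \<Rightarrow> real"
  assumes c: "continuous_on {0..1} g"
  shows "(integral {0..1} g)\<^sup>2 \<le> integral {0..1} (\<lambda>t. (g t)\<^sup>2)"
proof -
  define m where "m = integral {0..1} g"
  have "((\<lambda>t. (g t)\<^sup>2 - 2 * m * g t + m\<^sup>2) has_integral (integral {0..1} (\<lambda>t. (g t)\<^sup>2) - 2 * m * m + m\<^sup>2)) {0..1}"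
    unfolding m_def using has_integral_const_real[of "(integral {0..1} g)\<^sup>2" 0 1]
    by (intro has_integral_add has_integral_diff has_integral_mult_right integrable_integral
         integrable_continuous_real continuous_intros c) simp
  then have "0 \<le> integral {0..1} (\<lambda>t. (g t)\<^sup>2) - 2 * m * m + m\<^sup>2"
  proof (rule has_integral_nonneg)
    show "0 \<le> (g t)\<^sup>2 - 2 * m * g t + m\<^sup>2" for t
      using zero_le_power2[of "g t - m"] by (simp add: power2_diff algebra_simps)
  qed
  then show ?thesis by (simp add: m_def power2_eq_square)
qed

text \<open>The Wronskian with \<open>w\<close> is constantly \<open>g 0\<close>, and integrating it by parts gives
  \<open>g 0 = 2 \<integral> g w1\<close>, so boundary values are controlled by the \<open>L\<^sup>2\<close> norm.\<close>

lemma dirichlet_boundary_values: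
  assumes V: "V absolutely_integrable_on {0..1}"
    and w: "weak_ode V w w1" "w 0 = 0" "w1 0 = 1" "w 1 = 0"
  shows "weak_ode V g g1 \<Longrightarrow> g 1 * w1 1 = g 0"
    and "\<exists>C. \<forall>g g1. weak_ode V g g1 \<longrightarrow> (cmod (g 0))\<^sup>2 \<le> C * integral {0..1} (\<lambda>t. (cmod (g t))\<^sup>2)"
proof -
  have W: "g t * w1 t - g1 t * w t = g 0" if "weak_ode V g g1" "t \<in> {0..1}" for g g1 t
  proof -
    have "((\<lambda>s. 0) has_integral (g t * w1 t - g1 t * w t - (g 0 * w1 0 - g1 0 * w 0))) {0..t}"
      using weak_ode_wronskian[OF that(1) w(1) V V that(2)] by simp
    then show ?thesis using w by (simp add: has_integral_0_eq)
  qed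
  show "weak_ode V g g1 \<Longrightarrow> g 1 * w1 1 = g 0" using W[of g g1 1] w by simp
  note cw = weak_ode_continuous[OF w(1)]
  have "bounded (w1 ` {0..1})" by (intro compact_imp_bounded compact_continuous_image cw) auto
  then obtain M where M: "\<And>t. t \<in> {0..1} \<Longrightarrow> cmod (w1 t) \<le> M" unfolding bounded_iff by blast
  show "\<exists>C. \<forall>g g1. weak_ode V g g1 \<longrightarrow> (cmod (g 0))\<^sup>2 \<le> C * integral {0..1} (\<lambda>t. (cmod (g t))\<^sup>2)"
  \<comment> \<open>The constant depends only on the bound \<open>M\<close> for \<open>w1\<close>,
    so one constant serves the edges of all cells and the estimate can be summed.\<close>
  proof (intro exI[of _ "4 * M\<^sup>2"] allI impI)
    fix g g1 assume g: "weak_ode V g g1"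
    note cg = weak_ode_continuous[OF g]
    have "((\<lambda>t. g t * w t) has_vector_derivative g t * w1 t + g1 t * w t) (at t within {0..1})"
      if "t \<in> {0..1}" for t
      using g w(1) that by (auto simp: weak_ode_def intro!: has_vector_derivative_mult)
    then have "((\<lambda>t. g t * w1 t + g1 t * w t) has_integral (g 1 * w 1 - g 0 * w 0)) {0..1}"
      by (intro fundamental_theorem_of_calculus) auto
    moreover have "((\<lambda>t. g t * w1 t - g1 t * w t) has_integral g 0) {0..1}"
      using has_integral_const_real[of "g 0" 0 1] W[OF g]
      by (subst has_integral_cong[where g="\<lambda>_. g 0"]) auto
    \<comment> \<open>Adding the derivative of g w to the Wronskian cancels \<open>g1\<close>, whose
      size is not controlled by the L^2 norm of \<open>g\<close>.\<close>
    ultimately have "((\<lambda>t. (g t * w1 t + g1 t * w t) + (g t * w1 t - g1 t * w t)) has_integral (g 1 * w 1 - g 0 * w 0) + g 0) {0..1}"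
      by (rule has_integral_add)
    then have "((\<lambda>t. 2 * (g t * w1 t)) has_integral g 0) {0..1}" using w by (simp add: algebra_simps)
    moreover have "((\<lambda>t. 2 * M * cmod (g t)) has_integral 2 * M * integral {0..1} (\<lambda>t. cmod (g t))) {0..1}"
      by (intro has_integral_mult_right integrable_integral integrable_continuous_real continuous_intros cg)
    moreover have "cmod (2 * (g t * w1 t)) \<le> 2 * M * cmod (g t)" if "t \<in> {0..1}" for t
      using mult_right_mono[OF M[OF that], of "cmod (g t)"] by (simp add: norm_mult mult_ac)
    ultimately have "cmod (g 0) \<le> 2 * M * integral {0..1} (\<lambda>t. cmod (g t))"
      by (rule has_integral_norm_bound)
    then have "(cmod (g 0))\<^sup>2 \<le> (2 * M * integral {0..1} (\<lambda>t. cmod (g t)))\<^sup>2"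
      by (intro power_mono) auto
    also have "\<dots> = 4 * M\<^sup>2 * (integral {0..1} (\<lambda>t. cmod (g t)))\<^sup>2" by (simp add: power_mult_distrib)
    also have "\<dots> \<le> 4 * M\<^sup>2 * integral {0..1} (\<lambda>t. (cmod (g t))\<^sup>2)"
      by (intro mult_left_mono square_integral_le continuous_intros cg) auto
    finally show "(cmod (g 0))\<^sup>2 \<le> 4 * M\<^sup>2 * integral {0..1} (\<lambda>t. (cmod (g t))\<^sup>2)" .
  qed
qed

lemma weak_ode_multiple:
  assumes V: "V absolutely_integrable_on {0..1}"
    and w: "weak_ode V w w1" "w 0 = 0" "w1 0 = 1"
    and g: "weak_ode V g g1" "g 0 = 0" and t: "t \<in> {0..1}"
  shows "g t = g1 0 * w t" "g1 t = g1 0 * w1 t"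
  using weak_ode_unique[OF weak_ode_linear[OF g(1) w(1), of "- g1 0"] V, of 0 t] w g t by simp_all

text \<open>Splits the single sum over all edges in \<open>l2_graph\<close> into one condition per
  edge type, the form in which the recurrence over cells uses it.\<close>

lemma summable_on_Times_finite_iff:
  fixes F :: "int \<Rightarrow> nat \<Rightarrow> real"
  assumes "finite J"
  shows "(\<lambda>(n,j). F n j) summable_on (UNIV \<times> J) \<longleftrightarrow> (\<forall>j\<in>J. (\<lambda>n. F n j) summable_on UNIV)"
proof -
  have line: "(\<lambda>(n,j). F n j) summable_on ((\<lambda>n. (n, j)) ` UNIV) \<longleftrightarrow> (\<lambda>n. F n j) summable_on UNIV" for j
    by (subst summable_on_reindex) (auto simp: inj_on_def o_def)
  have U: "UNIV \<times> J = (\<Union>j\<in>J. (\<lambda>n::int. (n, j)) ` UNIV)" by auto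
  show ?thesis
  proof
    assume L: "(\<lambda>(n,j). F n j) summable_on (UNIV \<times> J)"
    show "\<forall>j\<in>J. (\<lambda>n. F n j) summable_on UNIV"
    proof
      fix j assume "j \<in> J"
      then have "(\<lambda>(n,j). F n j) summable_on ((\<lambda>n. (n, j)) ` UNIV)"
        by (intro summable_on_subset[OF L]) auto
      then show "(\<lambda>n. F n j) summable_on UNIV" by (simp add: line)
    qed
  next
    assume "\<forall>j\<in>J. (\<lambda>n. F n j) summable_on UNIV"
    then show "(\<lambda>(n,j). F n j) summable_on (UNIV \<times> J)"
      unfolding U by (intro summable_on_finite_union_disjoint assms) (auto simp: line)
  qed
qed

section \<open>Eigenfunctions on the graph\<close>

text \<open>The eigenvalue equation fixes \<open>f2\<close> only up to a negligible set, which the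
  integrated form does not see.\<close>

lemma eig_space_imp_weak_ode:
  assumes f: "f \<in> eig_space q a1 a2 N k \<mu>" and j: "j \<in> {1..6}"
  shows "weak_ode (potential q \<mu>) (f n j) (d01 (f n j))"
proof -
  obtain f2 where f2: "has_d2 (f n j) (f2 n j)"
    and neg: "negligible {t\<in>{0..1}. - f2 n j t + complex_of_real (q t) * f n j t \<noteq> \<mu> * f n j t}"
    using f j unfolding eig_space_def dom_H_def by blast
  obtain y1 where y1: "\<And>t. t \<in> {0..1} \<Longrightarrow> (f n j has_vector_derivative y1 t) (at t within {0..1})"
      "\<And>t. t \<in> {0..1} \<Longrightarrow> (f2 n j has_integral (y1 t - y1 0)) {0..t}"
    using f2 unfolding has_d2_def by blast
  have "weak_ode (potential q \<mu>) (f n j) y1" unfolding weak_ode_def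
  proof (intro conjI ballI y1(1))
    fix t :: real assume t: "t \<in> {0..1}"
    show "((\<lambda>s. potential q \<mu> s * f n j s) has_integral y1 t - y1 0) {0..t}"
    proof (rule has_integral_spike[OF neg _ y1(2)[OF t]])
      fix s assume "s \<in> {0..t} - {t \<in> {0..1}. - f2 n j t + complex_of_real (q t) * f n j t \<noteq> \<mu> * f n j t}"
      then have "- f2 n j s + complex_of_real (q s) * f n j s = \<mu> * f n j s" using t by auto
      then show "potential q \<mu> s * f n j s = f2 n j s" by (simp add: algebra_simps)
    qed
  qed
  then show ?thesis by (rule weak_ode_d01)
qed

lemma eig_space_vertex_values:
  assumes V: "potential q \<mu> absolutely_integrable_on {0..1}"
    and w: "weak_ode (potential q \<mu>) w w1" "w 0 = 0" "w1 0 = 1" "w 1 = 0" "w1 1 \<noteq> 0"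
    and f: "f \<in> eig_space q a1 a2 N k \<mu>"
  shows "\<forall>j\<in>{1..6}. f n j 0 = 0 \<and> f n j 1 = 0"
proof -
  note ode = eig_space_imp_weak_ode[OF f]
  have l2: "l2_graph f" and bc: "BC a1 a2 N k f" using f by (auto simp: eig_space_def dom_H_def)
  have end1: "f n j 1 * w1 1 = f n j 0" if "j \<in> {1..6}" for n j
    by (rule dirichlet_boundary_values(1)[OF V w(1-4) ode[OF that]])
  obtain C where C: "\<And>g g1. weak_ode (potential q \<mu>) g g1 \<Longrightarrow>
      (cmod (g 0))\<^sup>2 \<le> C * integral {0..1} (\<lambda>t. (cmod (g t))\<^sup>2)"
    using dirichlet_boundary_values(2)[OF V w(1-4)] by blast
  have v: "cis a1 * f n 1 1 = f n 2 0" "f n 2 0 = f n 5 0"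
     "cis a2 * f n 2 1 = f n 3 0" "f n 3 0 = f n 6 0"
     "cis a1 * f n 3 1 = f n 4 0" "f n 4 0 = cis a1 * f (n - 1) 6 1"
     "cis a2 * sroot N ^ k * f n 4 1 = f n 1 0" "f n 1 0 = cis (- a1) * f (n - 1) 5 1" for n
    using bc unfolding BC_def by blast+
  \<comment> \<open>Edges 3 and 6 of cell n start at one vertex, while edge 3 of cell n and edge 6
    of cell n - 1 end at one. Both ends carry the same phase, which cancels, so the value itself is
    invariant.\<close>
  have "f n 6 0 = f (n - 1) 6 0" for n
  proof -
    have "f n 3 1 = f (n - 1) 6 1" using v(5,6)[of n] by simp
    then show ?thesis using end1[of 3 n] end1[of 6 "n - 1"] v(4)[of n] by simp
  qed
  moreover have "l2_seq (\<lambda>n. f n 6 0)" unfolding l2_seq_def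
  proof (rule summable_on_comparison_test)
    have "(\<lambda>n. integral {0..1} (\<lambda>t. (cmod (f n 6 t))\<^sup>2)) summable_on UNIV"
      using l2 unfolding l2_graph_def by (simp add: summable_on_Times_finite_iff)
    then show "(\<lambda>n. C * integral {0..1} (\<lambda>t. (cmod (f n 6 t))\<^sup>2)) summable_on UNIV"
      by (rule summable_on_cmult_right)
    show "(cmod (f n 6 0))\<^sup>2 \<le> C * integral {0..1} (\<lambda>t. (cmod (f n 6 t))\<^sup>2)" for n
      using C[OF ode[of 6 n]] by simp
  qed auto
  ultimately have z6: "f n 6 0 = 0" for n by (rule l2_seq_invariant_imp_zero)
  then have z3: "f n 3 0 = 0" for n using v(4)[of n] by simp
  then have z2': "f n 2 1 = 0" for n using v(3)[of n] by simp
  then have z2: "f n 2 0 = 0" for n using end1[of 2 n] by simp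
  then have z5: "f n 5 0 = 0" and z1': "f n 1 1 = 0" for n using v(1,2)[of n] by simp_all
  then have z1: "f n 1 0 = 0" for n using end1[of 1 n] by simp
  have z3': "f n 3 1 = 0" for n using end1[of 3 n] z3 w(5) by simp
  then have z4: "f n 4 0 = 0" for n using v(5)[of n] by simp
  show ?thesis
  proof
    fix j :: nat assume j: "j \<in> {1..6}"
    have "\<forall>j\<in>{1..6}. f n j 0 = 0"
      unfolding ball_one_to_six using z1 z2 z3 z4 z5 z6 by simp
    then have "f n j 0 = 0" using j by blast
    then show "f n j 0 = 0 \<and> f n j 1 = 0" using end1[OF j, of n] w(5) by simp
  qed
qed

text \<open>Vanishing at the vertices reduces \<open>f\<close> on each edge to its slope at 0 times
  \<open>w\<close>. As \<open>w\<close> is not identically zero, the edge norms are a fixed nonzero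
  multiple of the moduli of the slopes, so square summability passes to \<open>A\<close>.\<close>

lemma eig_space_edges:
  assumes V: "potential q \<mu> absolutely_integrable_on {0..1}"
    and w: "weak_ode (potential q \<mu>) w w1" "w 0 = 0" "w1 0 = 1" "w 1 = 0" "w1 1 \<noteq> 0"
    and f: "f \<in> eig_space q a1 a2 N k \<mu>"
  defines "A \<equiv> (\<lambda>n j. d01 (f n j) 0)"
  shows "\<And>n j t. j \<in> {1..6} \<Longrightarrow> t \<in> {0..1} \<Longrightarrow> f n j t = A n j * w t"
    and "\<And>j. j \<in> {1..6} \<Longrightarrow> l2_seq (\<lambda>n. A n j)"
    and "currents (cis a1) (cis (- a1)) (cis a2) (sroot N ^ k) (w1 1) A"
proof -
  note ode = eig_space_imp_weak_ode[OF f] and vv = eig_space_vertex_values[OF V w f]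
  have l2: "l2_graph f" and bc: "BC a1 a2 N k f" using f by (auto simp: eig_space_def dom_H_def)
  show fA: "f n j t = A n j * w t" if "j \<in> {1..6}" "t \<in> {0..1}" for n j t
    unfolding A_def using weak_ode_multiple(1)[OF V w(1-3) ode[OF that(1)] _ that(2)] vv that by blast
  have dA: "d01 (f n j) 1 = w1 1 * A n j" if "j \<in> {1..6}" for n j
  proof -
    have "d01 (f n j) 1 = d01 (f n j) 0 * w1 1"
      using weak_ode_multiple(2)[OF V w(1-3) ode[OF that], of n 1] vv[of n] that by simp
    then show ?thesis by (simp add: A_def)
  qed
  have "\<forall>n. \<forall>j\<in>{1..6}. d01 (f n j) 1 = w1 1 * A n j" using dA by blast
  then have d: "d01 (f n 1) 1 = w1 1 * A n 1" "d01 (f n 2) 1 = w1 1 * A n 2"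
      "d01 (f n 3) 1 = w1 1 * A n 3" "d01 (f n 4) 1 = w1 1 * A n 4"
      "d01 (f n 5) 1 = w1 1 * A n 5" "d01 (f n 6) 1 = w1 1 * A n 6" for n
    unfolding ball_one_to_six by blast+
  show "currents (cis a1) (cis (- a1)) (cis a2) (sroot N ^ k) (w1 1) A"
    using bc unfolding BC_def currents_def d A_def by blast
  have c: "continuous_on {0..1} (\<lambda>s. (cmod (w s))\<^sup>2)"
    by (intro continuous_intros weak_ode_continuous[OF w(1)])
  define I where "I = integral {0..1} (\<lambda>s. (cmod (w s))\<^sup>2)"
  have "\<exists>t\<in>{0..1}. w t \<noteq> 0"
  proof (rule ccontr)
    assume "\<not> (\<exists>t\<in>{0..1}. w t \<noteq> 0)"
    then have "(w has_vector_derivative 0) (at 0 within {0..1})"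
      by (intro has_vector_derivative_transform[OF _ _ has_vector_derivative_const[of 0]]) auto
    then have "d01 w 0 = 0" unfolding d01_def by (intro vector_derivative_within_closed_interval) auto
    then show False using weak_ode_imp_d01[OF w(1), of 0] w(3) by simp
  qed
  then have "I \<noteq> 0" unfolding I_def using integral_eq_0_iff[OF c] by auto
  show "l2_seq (\<lambda>n. A n j)" if j: "j \<in> {1..6}" for j
  proof -
    have "(\<lambda>n. integral {0..1} (\<lambda>t. (cmod (f n j t))\<^sup>2)) summable_on UNIV"
      using l2 j unfolding l2_graph_def by (auto simp: summable_on_Times_finite_iff)
    moreover have "integral {0..1} (\<lambda>t. (cmod (f n j t))\<^sup>2) = (cmod (A n j))\<^sup>2 * I" for n
    proof -
      have "integral {0..1} (\<lambda>t. (cmod (f n j t))\<^sup>2) = integral {0..1} (\<lambda>t. (cmod (A n j))\<^sup>2 * (cmod (w t))\<^sup>2)"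
        by (rule integral_cong) (simp add: fA[OF j] norm_mult power_mult_distrib)
      then show ?thesis by (simp add: I_def)
    qed
    ultimately show ?thesis using \<open>I \<noteq> 0\<close> by (simp add: l2_seq_def summable_on_cmult_left')
  qed
qed

lemma l2_graph_edge_multiples:
  assumes u: "sq_int01 u"
    and g: "\<And>n j t. j \<in> {1..6} \<Longrightarrow> t \<in> {0..1} \<Longrightarrow> g n j t = A n j * u t"
    and A: "\<And>j. j \<in> {1..6} \<Longrightarrow> l2_seq (\<lambda>n. A n j)"
  shows "l2_graph g"
  unfolding l2_graph_def
proof (intro conjI allI ballI)
  show "sq_int01 (g n j)" if "j \<in> {1..6}" for n j
    by (rule sq_int01_cong[OF sq_int01_cmult[OF u]]) (rule g[OF that])
  have "(\<lambda>n. integral {0..1} (\<lambda>t. (cmod (g n j t))\<^sup>2)) summable_on UNIV" if j: "j \<in> {1..6}" for j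
  proof -
    have "integral {0..1} (\<lambda>t. (cmod (g n j t))\<^sup>2) = (cmod (A n j))\<^sup>2 * integral {0..1} (\<lambda>t. (cmod (u t))\<^sup>2)" for n
    proof -
      have "integral {0..1} (\<lambda>t. (cmod (g n j t))\<^sup>2) = integral {0..1} (\<lambda>t. (cmod (A n j))\<^sup>2 * (cmod (u t))\<^sup>2)"
        by (rule integral_cong) (simp add: g[OF j] norm_mult power_mult_distrib)
      then show ?thesis by simp
    qed
    then show ?thesis using A[OF j] by (simp add: l2_seq_def summable_on_cmult_left)
  qed
  then show "(\<lambda>(n,j). integral {0..1} (\<lambda>t. (cmod (g n j t))\<^sup>2)) summable_on (UNIV \<times> {1..6})"
    by (simp add: summable_on_Times_finite_iff)
qed

text \<open>Because \<open>w\<close> vanishes at both ends, the continuity conditions hold trivially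
  and the derivative conditions are exactly \<open>currents\<close>. The second derivative is square
  integrable since \<open>w\<close> is bounded and \<open>q\<close> is in L^2.\<close>

lemma edge_multiples_in_eig_space:
  assumes q: "q measurable_on {0..1}" "(\<lambda>t. (q t)\<^sup>2) integrable_on {0..1}"
    and w: "weak_ode (potential q \<mu>) w w1" "w 0 = 0" "w1 0 = 1" "w 1 = 0"
    and f: "\<And>n j t. j \<in> {1..6} \<Longrightarrow> t \<in> {0..1} \<Longrightarrow> f n j t = A n j * w t"
    and A: "\<And>j. j \<in> {1..6} \<Longrightarrow> l2_seq (\<lambda>n. A n j)"
    and cur: "currents (cis a1) (cis (- a1)) (cis a2) (sroot N ^ k) (w1 1) A"
  shows "f \<in> eig_space q a1 a2 N k \<mu>"
    and "\<And>n j. j \<in> {1..6} \<Longrightarrow> d01 (f n j) 0 = A n j"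
proof -
  define f2 where "f2 = (\<lambda>n j t. A n j * (potential q \<mu> t * w t))"
  have der: "(f n j has_vector_derivative A n j * w1 t) (at t within {0..1})"
    if j: "j \<in> {1..6}" and t: "t \<in> {0..1}" for n j t
  proof (rule has_vector_derivative_transform[OF t f[OF j]])
    show "((\<lambda>t. A n j * w t) has_vector_derivative A n j * w1 t) (at t within {0..1})"
      using w(1) t by (auto simp: weak_ode_def intro!: has_vector_derivative_mult_right)
  qed
  have d: "d01 (f n j) t = A n j * w1 t" if "j \<in> {1..6}" "t \<in> {0..1}" for n j t
    unfolding d01_def by (rule vector_derivative_within_closed_interval[OF _ _ der]) (use that in auto)
  show "d01 (f n j) 0 = A n j" if "j \<in> {1..6}" for n j using d[OF that, of 0 n] w(3) by simp
  have "has_d2 (f n j) (f2 n j)" if j: "j \<in> {1..6}" for n j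
    unfolding has_d2_def
  proof (intro exI[of _ "\<lambda>t. A n j * w1 t"] conjI ballI der[OF j])
    fix t :: real assume t: "t \<in> {0..1}"
    have "((\<lambda>s. potential q \<mu> s * w s) has_integral (w1 t - w1 0)) {0..t}"
      using w(1) t by (auto simp: weak_ode_def)
    from has_integral_mult_right[OF this, of "A n j"]
    show "(f2 n j has_integral A n j * w1 t - A n j * w1 0) {0..t}"
      by (simp add: f2_def right_diff_distrib)
  qed
  moreover have "l2_graph f"
    by (rule l2_graph_edge_multiples[OF sq_int01_continuous[OF weak_ode_continuous(1)[OF w(1)]] f A])
  moreover have "l2_graph f2"
    by (rule l2_graph_edge_multiples[where A=A, OF sq_int01_potential_mult[where \<mu>=\<mu>, OF q weak_ode_continuous(1)[OF w(1)]] _ A])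
       (simp add: f2_def)
  moreover have "BC a1 a2 N k f"
    using cur unfolding BC_def currents_def
    by (simp add: f d w ac_simps)
  moreover have "negligible {t\<in>{0..1}. - f2 n j t + complex_of_real (q t) * f n j t \<noteq> \<mu> * f n j t}"
    if j: "j \<in> {1..6}" for n j
  proof -
    have "{t\<in>{0..1}. - f2 n j t + complex_of_real (q t) * f n j t \<noteq> \<mu> * f n j t} = {}"
      using f[OF j] by (auto simp: f2_def algebra_simps)
    then show ?thesis by (simp only: negligible_empty)
  qed
  ultimately show "f \<in> eig_space q a1 a2 N k \<mu>"
    unfolding eig_space_def dom_H_def by blast
qed

section \<open>Linearity of the coefficients and the phase around a cell\<close>

lemma currents_linear:
  assumes "currents e1 i1 e2 z p A" "currents e1 i1 e2 z p B"
  shows "currents e1 i1 e2 z p (\<lambda>n j. A n j + c * B n j)"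
  unfolding currents_def
proof (intro allI)
  fix n
  have "e1 * (p * A n 1) - A n 2 - A n 5 = 0" "e2 * (p * A n 2) - A n 3 - A n 6 = 0"
       "e1 * (p * A n 3) - A n 4 + e1 * (p * A (n - 1) 6) = 0"
       "e2 * z * (p * A n 4) - A n 1 + i1 * (p * A (n - 1) 5) = 0"
       "e1 * (p * B n 1) - B n 2 - B n 5 = 0" "e2 * (p * B n 2) - B n 3 - B n 6 = 0"
       "e1 * (p * B n 3) - B n 4 + e1 * (p * B (n - 1) 6) = 0"
       "e2 * z * (p * B n 4) - B n 1 + i1 * (p * B (n - 1) 5) = 0"
    using assms unfolding currents_def by blast+
  then show "e1 * (p * (A n 1 + c * B n 1)) - (A n 2 + c * B n 2) - (A n 5 + c * B n 5) = 0 \<and>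
     e2 * (p * (A n 2 + c * B n 2)) - (A n 3 + c * B n 3) - (A n 6 + c * B n 6) = 0 \<and>
     e1 * (p * (A n 3 + c * B n 3)) - (A n 4 + c * B n 4) + e1 * (p * (A (n - 1) 6 + c * B (n - 1) 6)) = 0 \<and>
     e2 * z * (p * (A n 4 + c * B n 4)) - (A n 1 + c * B n 1) + i1 * (p * (A (n - 1) 5 + c * B (n - 1) 5)) = 0"
    by (intro conjI; algebra)
qed

lemma edge_coef_cong:
  assumes "\<And>j. j \<in> {1..6} \<Longrightarrow> A n j = B n j"
  shows "edge_coef b e1 e2 z p K A n \<nu> = edge_coef b e1 e2 z p K B n \<nu>"
  using assms[of 1] assms[of 2] assms[of 5] assms[of 6] by (simp add: edge_coef_def)

lemma edge_coef_linear:
  "edge_coef b e1 e2 z p K (\<lambda>n j. A n j + c * B n j) n \<nu> =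
   edge_coef b e1 e2 z p K A n \<nu> + c * edge_coef b e1 e2 z p K B n \<nu>"
  \<comment> \<open>For \<open>K = 0\<close> the quotients are 0 by convention, so linearity holds
    without assuming \<open>K\<close> nonzero.\<close>
  by (cases "K = 0") (simp_all add: edge_coef_def field_simps)

lemma l2_seq_edge_coef:
  assumes "\<And>j. j \<in> {1..6} \<Longrightarrow> l2_seq (\<lambda>n. A n j)"
  shows "l2_seq (\<lambda>n. edge_coef b e1 e2 z p K A n \<nu>)"
proof -
  have A: "l2_seq (\<lambda>n. A n 1)" "l2_seq (\<lambda>n. A n 2)" "l2_seq (\<lambda>n. A n 5)" "l2_seq (\<lambda>n. A n 6)"
    using assms[of 1] assms[of 2] assms[of 5] assms[of 6] by simp_all
  have "l2_seq (\<lambda>n. (1 / K) * (A n 5 + z * p * (e1 * e2 * e1) * A n 6))"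
       "l2_seq (\<lambda>n. (1 / K) * ((- e1) * A n 6 + (- p * (e1 * e2)) * A n 5))"
    by (intro l2_seq_cmult l2_seq_add A)+
  with A show ?thesis by (cases b; cases "\<nu> = 1") (simp_all add: edge_coef_def)
qed

lemma hatf_eq_edge_coef:
  "hatf a1 a2 N k p f = edge_coef (s_k a1 a2 N k = 0 \<and> p\<^sup>2 = 1) (cis a1) (cis a2) (sroot N ^ k) p
     (kappa1 a1 a2 N k p * kappa2 a1 a2 N k p) (\<lambda>n j. d01 (f n j) 0)"
  by (intro ext) (simp only: hatf_def edge_coef_def cis_mult)

text \<open>The left side is the product of the vertex phases around the cycle of edges 1 to 4; its
  angle is twice the argument of the sine in \<open>s_k\<close>, so \<open>s_k = 0\<close> says that
  this phase is trivial.\<close>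

lemma monodromy_factor:
  "sroot N ^ k * cis (2 * (a1 + a2)) = cis (2 * (pi * real k / real N + (a1 + a2)))"
proof -
  have "real k * (2 * pi / real N) + 2 * (a1 + a2) = 2 * (pi * real k / real N + (a1 + a2))"
    by (simp add: algebra_simps)
  then show ?thesis unfolding sroot_def Complex.DeMoivre cis_mult by (rule arg_cong)
qed

lemma s_k_zero_iff:
  "s_k a1 a2 N k = 0 \<longleftrightarrow> sroot N ^ k * cis (2 * (a1 + a2)) = 1"
proof -
  define \<theta> where "\<theta> = pi * real k / real N + (a1 + a2)"
  have "cis (2 * \<theta>) = 1 \<longleftrightarrow> sin \<theta> = 0"
    using cos_double_sin[of \<theta>] sin_double[of \<theta>] by (auto simp: complex_eq_iff)
  then show ?thesis using monodromy_factor by (simp add: s_k_def \<theta>_def)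
qed

text \<open>A vanishing kappa would be an equation u x = 1 with |u| = 1 and x a nonnegative real,
  namely x = p^2 or x = p^4. Taking moduli gives x = 1, hence p^2 = 1 and u = 1, the excluded case.
  Reality of \<open>p\<close> enters here: p^2 = -1 would also give p^4 = 1.\<close>

lemma kappa_nonzero:
  assumes p: "cnj p = p" and nd: "\<not> (s_k a1 a2 N k = 0 \<and> p\<^sup>2 = 1)"
  shows "kappa1 a1 a2 N k p \<noteq> 0" "kappa2 a1 a2 N k p \<noteq> 0"
proof -
  obtain r where r: "p = complex_of_real r" using p by (metis Reals_cases Reals_cnj_iff)
  define u where "u = sroot N ^ k * cis (2 * (a1 + a2))"
  have nu: "cmod u = 1" using monodromy_factor by (simp add: u_def)
  have nd': "u = 1 \<Longrightarrow> p\<^sup>2 \<noteq> 1" using nd s_k_zero_iff by (simp add: u_def)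
  have 1: "x \<noteq> 1" if "x \<ge> 0" "u * complex_of_real x = 1" "x = 1 \<Longrightarrow> p\<^sup>2 = 1" for x
    using that nd' by auto
  have 2: "u * complex_of_real x \<noteq> 1" if "x \<ge> 0" "x = 1 \<Longrightarrow> p\<^sup>2 = 1" for x
  proof
    assume a: "u * complex_of_real x = 1"
    then have "cmod (u * complex_of_real x) = 1" by simp
    then have "x = 1" using nu that(1) by (simp add: norm_mult)
    then show False using 1[OF that(1) a that(2)] by simp
  qed
  show "kappa1 a1 a2 N k p \<noteq> 0"
    using 2[of "r\<^sup>2"] by (auto simp: kappa1_def u_def r simp flip: of_real_power)
  have "r\<^sup>2 = 1" if "r ^ 4 = 1"
  proof -
    have "(r\<^sup>2)\<^sup>2 = 1\<^sup>2" using that by simp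
    then show ?thesis by (metis power2_eq_iff_nonneg zero_le_one zero_le_power2)
  qed
  then show "kappa2 a1 a2 N k p \<noteq> 0"
    using 2[of "r ^ 4"] by (auto simp: kappa2_def u_def r simp flip: of_real_power)
qed

text \<open>At a fixed point of cell m only the shifts n = m and n = m - 1 contribute, so the
  expansion is a finite sum pointwise.\<close>

lemma has_sum_two_term:
  "((\<lambda>(n,\<nu>). h n \<nu> * ((if m - n = 0 then \<alpha> j \<nu> else if m - n = 1 then \<beta> j \<nu> else 0) * x))
     has_sum two_term \<alpha> \<beta> h m j * x) (UNIV \<times> {1, 2})"
proof (rule has_sum_finite_neutralI[where B="{m, m - 1} \<times> {1, 2}"])
  show "two_term \<alpha> \<beta> h m j * x = (\<Sum>(n,\<nu>)\<in>{m, m - 1} \<times> {1, 2}.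
      h n \<nu> * ((if m - n = 0 then \<alpha> j \<nu> else if m - n = 1 then \<beta> j \<nu> else 0) * x))"
    by (simp add: sum.cartesian_product[symmetric] two_term_def algebra_simps)
qed (auto split: if_splits)

text \<open>Gives both cases one interface, so that the expansion, injectivity and surjectivity can
  be proved without a case distinction.\<close>

lemma currents_parametrization:
  fixes p :: complex and a1 a2 :: real and N k :: nat
  assumes "cnj p = p"
  defines "b \<equiv> (s_k a1 a2 N k = 0 \<and> p\<^sup>2 = 1)"
    and "K \<equiv> kappa1 a1 a2 N k p * kappa2 a1 a2 N k p"
  obtains \<alpha> \<beta> where
    "\<And>h. currents (cis a1) (cis (- a1)) (cis a2) (sroot N ^ k) p (two_term \<alpha> \<beta> h)"
    "\<And>h n \<nu>. \<nu> \<in> {1,2} \<Longrightarrow>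
       edge_coef b (cis a1) (cis a2) (sroot N ^ k) p K (two_term \<alpha> \<beta> h) n \<nu> = h n \<nu>"
    "\<And>A n j. currents (cis a1) (cis (- a1)) (cis a2) (sroot N ^ k) p A \<Longrightarrow>
       (\<And>j. j \<in> {1..6} \<Longrightarrow> l2_seq (\<lambda>n. A n j)) \<Longrightarrow> j \<in> {1..6} \<Longrightarrow>
       A n j = two_term \<alpha> \<beta> (edge_coef b (cis a1) (cis a2) (sroot N ^ k) p K A) n j"
proof -
  have e1: "cis a1 * cis (- a1) = 1" by (simp add: cis_mult)
  have sq: "cis (2 * (a1 + a2)) = (cis a1 * cis a2)\<^sup>2"
    by (simp add: cis_mult Complex.DeMoivre)
  show ?thesis
  proof (cases b)
    case True
    then have "sroot N ^ k * (cis a1 * cis a2)\<^sup>2 = 1" "p\<^sup>2 = 1"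
      unfolding b_def s_k_zero_iff sq by blast+
    from currents_parametrization_degenerate[OF e1 this, of K] obtain \<alpha> \<beta> where par:
      "\<And>h. currents (cis a1) (cis (- a1)) (cis a2) (sroot N ^ k) p (two_term \<alpha> \<beta> h)"
      "\<And>h n \<nu>. \<nu> \<in> {1,2} \<Longrightarrow>
         edge_coef True (cis a1) (cis a2) (sroot N ^ k) p K (two_term \<alpha> \<beta> h) n \<nu> = h n \<nu>"
      "\<And>A n j. currents (cis a1) (cis (- a1)) (cis a2) (sroot N ^ k) p A \<Longrightarrow>
         (\<And>j. j \<in> {1..6} \<Longrightarrow> l2_seq (\<lambda>n. A n j)) \<Longrightarrow> j \<in> {1..6} \<Longrightarrow>
         A n j = two_term \<alpha> \<beta> (edge_coef True (cis a1) (cis a2) (sroot N ^ k) p K A) n j"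
      by blast
    from True have "b = True" by simp
    then show ?thesis using that[of \<alpha> \<beta>] par by (simp only:)
  next
    case False
    then have k: "kappa1 a1 a2 N k p \<noteq> 0" "kappa2 a1 a2 N k p \<noteq> 0"
      using kappa_nonzero[OF assms(1)] by (simp_all add: b_def)
    from currents_parametrization_generic[OF e1 kappa1_def[of a1 a2 N k p, unfolded sq] k(1) kappa2_def[of a1 a2 N k p, unfolded sq] k(2)]
    obtain \<alpha> \<beta> where par:
      "\<And>h. currents (cis a1) (cis (- a1)) (cis a2) (sroot N ^ k) p (two_term \<alpha> \<beta> h)"
      "\<And>h n \<nu>. \<nu> \<in> {1,2} \<Longrightarrow>
         edge_coef False (cis a1) (cis a2) (sroot N ^ k) p K (two_term \<alpha> \<beta> h) n \<nu> = h n \<nu>"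
      "\<And>A n j. currents (cis a1) (cis (- a1)) (cis a2) (sroot N ^ k) p A \<Longrightarrow> j \<in> {1..6} \<Longrightarrow>
         A n j = two_term \<alpha> \<beta> (edge_coef False (cis a1) (cis a2) (sroot N ^ k) p K A) n j"
      unfolding K_def by blast
    from False have "b = False" by simp
    then show ?thesis using that[of \<alpha> \<beta>] par by (simp only:)
  qed
qed

theorem theorem2p2:
  fixes q :: "real \<Rightarrow> real" and N k :: nat and a1 a2 :: real and \<mu> :: complex
  assumes q_L2: "q measurable_on {0..1}" "(\<lambda>t. (q t)\<^sup>2) integrable_on {0..1}"
    and N: "N \<ge> 1" and k: "k < N"
    and mu: "\<mu> \<in> dir_spec q"
  defines "\<phi> \<equiv> phi_d1 q \<mu>"
    and "H \<equiv> eig_space q a1 a2 N k \<mu>"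
    and "hat \<equiv> hatf a1 a2 N k (phi_d1 q \<mu>)"
  shows
    "(\<forall>f\<in>H. \<forall>n. \<forall>j\<in>{1..6}. f n j 0 = 0 \<and> f n j 1 = 0)
     \<and> (\<not> (s_k a1 a2 N k = 0 \<and> \<phi>\<^sup>2 = 1) \<longrightarrow>
          kappa1 a1 a2 N k \<phi> \<noteq> 0 \<and> kappa2 a1 a2 N k \<phi> \<noteq> 0)
     \<and> (\<exists>\<psi> :: nat \<Rightarrow> int \<Rightarrow> nat \<Rightarrow> real \<Rightarrow> complex.
          (\<forall>\<nu>\<in>{1,2}. \<psi> \<nu> \<in> H)
        \<and> (\<forall>\<nu>\<in>{1,2}. \<forall>n. \<forall>j\<in>{1..6}. \<forall>t\<in>{0..1}. n \<notin> {0,1} \<longrightarrow> \<psi> \<nu> n j t = 0)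
        \<and> (\<forall>\<nu>\<in>{1,2}. \<forall>n. shift n (\<psi> \<nu>) \<in> H)
        \<and> (\<forall>f\<in>H. l2_seq (\<lambda>n. hat f n 1) \<and> l2_seq (\<lambda>n. hat f n 2) \<and>
             (\<forall>m. \<forall>j\<in>{1..6}. \<forall>t\<in>{0..1}.
                ((\<lambda>(n,\<nu>). hat f n \<nu> * shift n (\<psi> \<nu>) m j t) has_sum f m j t) (UNIV \<times> {1,2}))))
     \<and> (\<forall>f\<in>H. \<forall>g\<in>H. \<forall>c. (\<lambda>n j t. f n j t + c * g n j t) \<in> H \<and>
          (\<forall>n. \<forall>\<nu>\<in>{1,2}. hat (\<lambda>n j t. f n j t + c * g n j t) n \<nu> = hat f n \<nu> + c * hat g n \<nu>))
     \<and> (\<forall>f\<in>H. \<forall>g\<in>H. (\<forall>n. \<forall>\<nu>\<in>{1,2}. hat f n \<nu> = hat g n \<nu>) \<longrightarrow> graph_eq f g)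
     \<and> (\<forall>c :: int \<Rightarrow> nat \<Rightarrow> complex. l2_seq (\<lambda>n. c n 1) \<and> l2_seq (\<lambda>n. c n 2) \<longrightarrow>
          (\<exists>f\<in>H. \<forall>n. \<forall>\<nu>\<in>{1,2}. hat f n \<nu> = c n \<nu>))"
proof -
  note V = potential_absolutely_integrable[OF q_L2]
  obtain w w1 where w: "weak_ode (potential q \<mu>) w w1" "w 0 = 0" "w1 0 = 1" "w 1 = 0"
    and p: "w1 1 = \<phi>" "\<phi> \<noteq> 0" "cnj \<phi> = \<phi>"
    unfolding \<phi>_def by (rule dirichlet_eigenfunction[OF q_L2 mu])
  have w1: "w1 1 \<noteq> 0" using p by simp
  let ?cur = "currents (cis a1) (cis (- a1)) (cis a2) (sroot N ^ k) \<phi>"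
  define ec where "ec = edge_coef (s_k a1 a2 N k = 0 \<and> \<phi>\<^sup>2 = 1) (cis a1) (cis a2) (sroot N ^ k) \<phi>
     (kappa1 a1 a2 N k \<phi> * kappa2 a1 a2 N k \<phi>)"
  have hat: "hat f = ec (\<lambda>n j. d01 (f n j) 0)" for f
    by (simp only: hat_def ec_def hatf_eq_edge_coef \<phi>_def)
  have ec_cong: "ec A n \<nu> = ec B n \<nu>" if "\<And>j. j \<in> {1..6} \<Longrightarrow> A n j = B n j" for A B n \<nu>
    unfolding ec_def using that by (rule edge_coef_cong)
  note edges = eig_space_edges[where ?a1.0=a1 and ?a2.0=a2 and N=N and k=k, OF V w w1, folded H_def, unfolded p(1)]
  note intro_H = edge_multiples_in_eig_space[where ?a1.0=a1 and ?a2.0=a2 and N=N and k=k, OF q_L2 w, folded H_def, unfolded p(1)]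
  obtain \<alpha> \<beta> where par: "\<And>h. ?cur (two_term \<alpha> \<beta> h)"
    "\<And>h n \<nu>. \<nu> \<in> {1,2} \<Longrightarrow> ec (two_term \<alpha> \<beta> h) n \<nu> = h n \<nu>"
    "\<And>A n j. ?cur A \<Longrightarrow> (\<And>j. j \<in> {1..6} \<Longrightarrow> l2_seq (\<lambda>n. A n j)) \<Longrightarrow> j \<in> {1..6} \<Longrightarrow>
       A n j = two_term \<alpha> \<beta> (ec A) n j"
    unfolding ec_def using currents_parametrization[OF p(3)] by metis
  have rep: "f n j t = two_term \<alpha> \<beta> (hat f) n j * w t"
    if "f \<in> H" "j \<in> {1..6}" "t \<in> {0..1}" for f n j t
    using edges(1)[OF that] par(3)[OF edges(3,2)[OF that(1)] that(2)] unfolding hat by metis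
  define \<psi> :: "nat \<Rightarrow> int \<Rightarrow> nat \<Rightarrow> real \<Rightarrow> complex" where
    "\<psi> = (\<lambda>\<nu> n j t. (if n = 0 then \<alpha> j \<nu> else if n = 1 then \<beta> j \<nu> else 0) * w t)"
  have shift_H: "shift m (\<psi> \<nu>) \<in> H" if "\<nu> \<in> {1,2}" for m \<nu>
  proof -
    \<comment> \<open>The shifted basic eigenfunction is the one whose coefficient family is the
      indicator of the single index (m, \<nu>).\<close>
    define h where "h = (\<lambda>n \<nu>'. if n = m then (if \<nu>' = \<nu> then 1 else 0) else 0 :: complex)"
    show ?thesis
    proof (rule intro_H(1)[of _ "two_term \<alpha> \<beta> h"])
      show "shift m (\<psi> \<nu>) n j t = two_term \<alpha> \<beta> h n j * w t" for n j t
        using that by (auto simp: shift_def \<psi>_def two_term_def h_def)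
      show "l2_seq (\<lambda>n. two_term \<alpha> \<beta> h n j)" for j
        unfolding h_def by (intro l2_seq_two_term l2_seq_delta)
    qed (rule par(1))
  qed
  have "shift 0 (\<psi> \<nu>) = \<psi> \<nu>" for \<nu> by (simp add: shift_def)
  then have psi_H: "\<psi> \<nu> \<in> H" if "\<nu> \<in> {1,2}" for \<nu> using shift_H[OF that, of 0] by simp
  have vertex: "\<forall>f\<in>H. \<forall>n. \<forall>j\<in>{1..6}. f n j 0 = 0 \<and> f n j 1 = 0"
    using eig_space_vertex_values[OF V w w1] unfolding H_def by blast
  have l2_hat: "l2_seq (\<lambda>n. hat f n \<nu>)" if "f \<in> H" for f \<nu>
    unfolding hat ec_def by (rule l2_seq_edge_coef[OF edges(2)[OF that]])
  have expansion: "((\<lambda>(n,\<nu>). hat f n \<nu> * shift n (\<psi> \<nu>) m j t) has_sum f m j t) (UNIV \<times> {1,2})"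
    if "f \<in> H" "j \<in> {1..6}" "t \<in> {0..1}" for f m j t
    unfolding rep[OF that] shift_def \<psi>_def by (rule has_sum_two_term)
  have linear: "(\<lambda>n j t. f n j t + c * g n j t) \<in> H \<and>
      (\<forall>n. \<forall>\<nu>\<in>{1,2}. hat (\<lambda>n j t. f n j t + c * g n j t) n \<nu> = hat f n \<nu> + c * hat g n \<nu>)"
    if f: "f \<in> H" and g: "g \<in> H" for f g c
  proof -
    \<comment> \<open>Closure under linear combinations is obtained on the level of slopes, where
      only \<open>currents\<close> and square summability have to be checked.\<close>
    define A where "A = (\<lambda>n j. d01 (f n j) 0 + c * d01 (g n j) 0)"
    have 1: "f n j t + c * g n j t = A n j * w t" if "j \<in> {1..6}" "t \<in> {0..1}" for n j t
      using edges(1)[OF f that, of n] edges(1)[OF g that, of n] by (simp add: A_def algebra_simps)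
    have 2: "l2_seq (\<lambda>n. A n j)" if "j \<in> {1..6}" for j
      unfolding A_def by (intro l2_seq_add l2_seq_cmult edges(2) f g that)
    have 3: "?cur A" unfolding A_def by (intro currents_linear edges(3) f g)
    note fg = intro_H[OF 1 2 3]
    have "hat (\<lambda>n j t. f n j t + c * g n j t) n \<nu> = ec A n \<nu>" for n \<nu>
      unfolding hat by (rule ec_cong) (rule fg(2))
    also have "ec A n \<nu> = hat f n \<nu> + c * hat g n \<nu>" for n \<nu>
      unfolding hat A_def ec_def by (rule edge_coef_linear)
    finally show ?thesis using fg(1) by simp
  qed
  have inj: "graph_eq f g" if f: "f \<in> H" and g: "g \<in> H"
    and eq: "\<forall>n. \<forall>\<nu>\<in>{1,2}. hat f n \<nu> = hat g n \<nu>" for f g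
    unfolding graph_eq_def using rep[OF f] rep[OF g] eq by (simp add: two_term_def)
  have surj: "\<exists>f\<in>H. \<forall>n. \<forall>\<nu>\<in>{1,2}. hat f n \<nu> = c n \<nu>"
    if c: "l2_seq (\<lambda>n. c n 1)" "l2_seq (\<lambda>n. c n 2)" for c
  proof -
    define f where "f = (\<lambda>n j t. two_term \<alpha> \<beta> c n j * w t)"
    have f: "f n j t = two_term \<alpha> \<beta> c n j * w t" for n j t by (simp add: f_def)
    note fH = intro_H[OF f l2_seq_two_term[OF c] par(1)]
    have "hat f n \<nu> = c n \<nu>" if "\<nu> \<in> {1,2}" for n \<nu>
    proof -
      have "hat f n \<nu> = ec (two_term \<alpha> \<beta> c) n \<nu>" unfolding hat by (rule ec_cong) (rule fH(2))
      then show ?thesis using par(2)[OF that] by simp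
    qed
    then show ?thesis using fH(1) by blast
  qed
  show ?thesis
    apply (intro conjI exI[of _ \<psi>] ballI allI impI)
    subgoal using vertex by blast
    subgoal using vertex by blast
    subgoal using kappa_nonzero(1)[OF p(3)] by blast
    subgoal using kappa_nonzero(2)[OF p(3)] by blast
    subgoal using psi_H by blast
    subgoal by (simp add: \<psi>_def)
    subgoal using shift_H by blast
    subgoal using l2_hat by blast
    subgoal using l2_hat by blast
    subgoal using expansion by blast
    subgoal using linear by blast
    subgoal using linear by blast
    subgoal using inj by blast
    subgoal using surj by blast
    done
qed

end
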